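(* Let $(a,b,c)\in\mathbb{R}_{>0}^3$ satisfy $ac+bc+3ab<c^2$. Then the Glauber dynamics for the six-vertex model with weights $(a,b,c)$ on $\Lambda_n$ with free boundary conditions mixes exponentially slowly, i.e. its mixing time $\tau(1/4)$ is $\Omega(\exp(n^{\kappa}))$ for some constant $\kappa>0$.
   Context: $\Lambda_n$ is the $n\times n$ square grid of $\mathbb{Z}^2$ together with $4n$ additional dangling boundary edges, so that each of the $n^2$ vertices has degree 4. A configuration is an orientation of all edges in which every vertex has exactly two incoming and two outgoing edges. At a vertex $v$ the six possible local configurations fall into three classes: type $a$ (horizontal edges both pointing right and vertical edges both pointing up, or both left and both down), type $b$ (horizontal both right and vertical both down, or horizontal both left and vertical both up), and type $c$ (both horizontal edges point into $v$ and both vertical edges point out of $v$, or vice versa). With free boundary conditions the orientations of the dangling edges are not fixed: the state space $\Omega$ is the set of all such orientations. The Boltzmann distribution is $\pi(x)\propto a^{n_a(x)}b^{n_b(x)}c^{n_c(x)}$, where $n_a,n_b,n_c$ count vertices of each type. Glauber dynamics: from state $x$, choose uniformly at random a cell of the grid; if its four bounding edges form a directed cycle, let $y$ be the state obtained by reversing them and move to $y$ with probability $\min(1,\pi(y)/\pi(x))$; otherwise stay. The mixing time is $\tau(1/4)=\min\{t\ge0:\max_{x}\|P^t(x,\cdot)-\pi\|_{TV}\le 1/4\}$. *)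

theory Defs
  imports Complex_Main "HOL-Library.Extended_Real"
begin

section \<open>The lattice region\<close>

text \<open>The vertices of \<open>\<Lambda>\<^sub>n\<close> are the points of \<open>{1..n}\<^sup>2\<close>.  \<open>Hor i j\<close> is the edge of
  \<open>\<int>\<^sup>2\<close> from \<open>(i, j)\<close> to \<open>(i + 1, j)\<close> and \<open>Ver i j\<close> the one from \<open>(i, j)\<close> to
  \<open>(i, j + 1)\<close>.  The dangling edges are \<open>Hor 0 j\<close>, \<open>Hor n j\<close>, \<open>Ver i 0\<close>, \<open>Ver i n\<close>.\<close>

datatype edge = Hor int int | Ver int int

definition vertices :: "nat \<Rightarrow> (int \<times> int) set" where
  "vertices n = {1..int n} \<times> {1..int n}"

definition edges :: "nat \<Rightarrow> edge set" where
  "edges n = {Hor i j | i j. i \<in> {0..int n} \<and> j \<in> {1..int n}}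
           \<union> {Ver i j | i j. i \<in> {1..int n} \<and> j \<in> {0..int n}}"

section \<open>Configurations with free boundary conditions\<close>

text \<open>An orientation is encoded by the set of edges that point right or up; all other edges
  of the region point left or down.\<close>

fun in_edges :: "edge set \<Rightarrow> int \<times> int \<Rightarrow> edge set" where
  "in_edges x (i, j) = ({Hor (i - 1) j, Ver i (j - 1)} \<inter> x) \<union> ({Hor i j, Ver i j} - x)"

fun out_edges :: "edge set \<Rightarrow> int \<times> int \<Rightarrow> edge set" where
  "out_edges x (i, j) = ({Hor (i - 1) j, Ver i (j - 1)} - x) \<union> ({Hor i j, Ver i j} \<inter> x)"

definition states :: "nat \<Rightarrow> edge set set" where
  "states n = {x. x \<subseteq> edges n \<and>
     (\<forall>v\<in>vertices n. card (in_edges x v) = 2 \<and> card (out_edges x v) = 2)}"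

fun type_a :: "edge set \<Rightarrow> int \<times> int \<Rightarrow> bool" where
  "type_a x (i, j) \<longleftrightarrow>
     (Hor (i - 1) j \<in> x \<and> Hor i j \<in> x \<and> Ver i (j - 1) \<in> x \<and> Ver i j \<in> x) \<or>
     (Hor (i - 1) j \<notin> x \<and> Hor i j \<notin> x \<and> Ver i (j - 1) \<notin> x \<and> Ver i j \<notin> x)"

fun type_b :: "edge set \<Rightarrow> int \<times> int \<Rightarrow> bool" where
  "type_b x (i, j) \<longleftrightarrow>
     (Hor (i - 1) j \<in> x \<and> Hor i j \<in> x \<and> Ver i (j - 1) \<notin> x \<and> Ver i j \<notin> x) \<or>
     (Hor (i - 1) j \<notin> x \<and> Hor i j \<notin> x \<and> Ver i (j - 1) \<in> x \<and> Ver i j \<in> x)"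

fun type_c :: "edge set \<Rightarrow> int \<times> int \<Rightarrow> bool" where
  "type_c x (i, j) \<longleftrightarrow>
     (Hor (i - 1) j \<in> x \<and> Hor i j \<notin> x \<and> Ver i (j - 1) \<notin> x \<and> Ver i j \<in> x) \<or>
     (Hor (i - 1) j \<notin> x \<and> Hor i j \<in> x \<and> Ver i (j - 1) \<in> x \<and> Ver i j \<notin> x)"

definition weight :: "nat \<Rightarrow> real \<Rightarrow> real \<Rightarrow> real \<Rightarrow> edge set \<Rightarrow> real" where
  "weight n a b c x =
     a ^ card {v \<in> vertices n. type_a x v} *
     b ^ card {v \<in> vertices n. type_b x v} *
     c ^ card {v \<in> vertices n. type_c x v}"

definition boltzmann :: "nat \<Rightarrow> real \<Rightarrow> real \<Rightarrow> real \<Rightarrow> edge set \<Rightarrow> real" where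
  "boltzmann n a b c x = weight n a b c x / (\<Sum>z\<in>states n. weight n a b c z)"

section \<open>Glauber dynamics\<close>

text \<open>A cell of \<open>\<int>\<^sup>2\<close> is named by its lower left corner \<open>(p, q)\<close>.  The inner cells are the
  unit squares of the \<open>n \<times> n\<close> grid, each bounded by four edges of \<open>\<Lambda>\<^sub>n\<close>.  The boundary
  cells, at which dangling edges occur, have only three sides in \<open>\<Lambda>\<^sub>n\<close>, or two at the corners.
  Flips of inner cells never change a dangling edge, so with free boundary conditions the
  dynamics can only be irreducible if boundary cells are updated as well.\<close>

definition inner_cells :: "nat \<Rightarrow> (int \<times> int) set" where
  "inner_cells n = {1..int n - 1} \<times> {1..int n - 1}"

definition all_cells :: "nat \<Rightarrow> (int \<times> int) set" where
  "all_cells n = {0..int n} \<times> {0..int n}"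

text \<open>The sides of a cell lying in \<open>\<Lambda>\<^sub>n\<close>: in a counterclockwise cycle the bottom and right
  sides point right and up, the top and left sides point left and down.\<close>

fun bottom_right :: "nat \<Rightarrow> int \<times> int \<Rightarrow> edge set" where
  "bottom_right n (p, q) = {Hor p q, Ver (p + 1) q} \<inter> edges n"

fun top_left :: "nat \<Rightarrow> int \<times> int \<Rightarrow> edge set" where
  "top_left n (p, q) = {Hor p (q + 1), Ver p q} \<inter> edges n"

text \<open>For a boundary cell the sides outside \<open>\<Lambda>\<^sub>n\<close> carry no orientation and impose no
  constraint.\<close>

definition directed_cycle :: "nat \<Rightarrow> edge set \<Rightarrow> int \<times> int \<Rightarrow> bool" where
  "directed_cycle n x f \<longleftrightarrow>
     (bottom_right n f \<subseteq> x \<and> top_left n f \<inter> x = {}) \<or>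
     (top_left n f \<subseteq> x \<and> bottom_right n f \<inter> x = {})"

definition reverse_cell :: "nat \<Rightarrow> edge set \<Rightarrow> int \<times> int \<Rightarrow> edge set" where
  "reverse_cell n x f =
     (let B = bottom_right n f \<union> top_left n f in (x - B) \<union> (B - x))"

definition cell_update ::
  "nat \<Rightarrow> real \<Rightarrow> real \<Rightarrow> real \<Rightarrow> int \<times> int \<Rightarrow> edge set \<Rightarrow> edge set \<Rightarrow> real" where
  "cell_update n a b c f x y =
     (if directed_cycle n x f
      then let x' = reverse_cell n x f;
               r = min 1 (boltzmann n a b c x' / boltzmann n a b c x)
           in r * of_bool (y = x') + (1 - r) * of_bool (y = x)
      else of_bool (y = x))"

text \<open>Transition matrix of the dynamics choosing uniformly from the nonempty set \<open>C\<close> of cells.\<close>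

definition glauber ::
  "(int \<times> int) set \<Rightarrow> nat \<Rightarrow> real \<Rightarrow> real \<Rightarrow> real \<Rightarrow> edge set \<Rightarrow> edge set \<Rightarrow> real" where
  "glauber C n a b c x y = (\<Sum>f\<in>C. cell_update n a b c f x y) / real (card C)"

section \<open>Mixing time\<close>

primrec matrix_power :: "'s set \<Rightarrow> ('s \<Rightarrow> 's \<Rightarrow> real) \<Rightarrow> nat \<Rightarrow> 's \<Rightarrow> 's \<Rightarrow> real" where
  "matrix_power S P 0 x y = of_bool (x = y)"
| "matrix_power S P (Suc t) x y = (\<Sum>z\<in>S. P x z * matrix_power S P t z y)"

definition tv_dist :: "'s set \<Rightarrow> ('s \<Rightarrow> real) \<Rightarrow> ('s \<Rightarrow> real) \<Rightarrow> real" where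
  "tv_dist S \<mu> \<nu> = (\<Sum>y\<in>S. \<bar>\<mu> y - \<nu> y\<bar>) / 2"

text \<open>The value is \<open>\<infinity>\<close> if the chain never comes within distance \<open>\<epsilon>\<close> of \<open>\<pi>\<close>.\<close>

definition mixing_time ::
  "'s set \<Rightarrow> ('s \<Rightarrow> 's \<Rightarrow> real) \<Rightarrow> ('s \<Rightarrow> real) \<Rightarrow> real \<Rightarrow> enat" where
  "mixing_time S P \<pi> \<epsilon> =
     Inf (enat ` {t. Max ((\<lambda>x. tv_dist S (matrix_power S P t x) \<pi>) ` S) \<le> \<epsilon>})"

definition glauber_mixing_time ::
  "(int \<times> int) set \<Rightarrow> nat \<Rightarrow> real \<Rightarrow> real \<Rightarrow> real \<Rightarrow> enat" where
  "glauber_mixing_time C n a b c =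
     mixing_time (states n) (glauber C n a b c) (boltzmann n a b c) (1/4)"

definition exponentially_slow :: "(nat \<Rightarrow> enat) \<Rightarrow> bool" where
  "exponentially_slow \<tau> \<longleftrightarrow>
     (\<exists>\<kappa>>0. \<exists>K>0. \<forall>\<^sub>F n in sequentially.
        ereal (K * exp (real n powr \<kappa>)) \<le> ereal_of_enat (\<tau> n))"

end

theory Submission
  imports Defs "HOL-Real_Asymp.Real_Asymp"
begin

text \<open>The vertices of type \<open>a\<close> and \<open>b\<close> carry domain walls between the two ground states made of
  type \<open>c\<close> vertices, and every inner cell meets an even number of walls.  A longest trail of walls
  is therefore closed or ends at the boundary, and reversing the edges on one side of it turns its
  vertices into type \<open>c\<close>; so a given trail is the longest one with probability at most the product
  of its weights \<open>a / c\<close> and \<open>b / c\<close>.  By the hypothesis the total weight of non-backtracking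
  walks decays exponentially in their length, hence trails of length \<open>n div 3\<close> are exponentially
  unlikely.  If there are none, all wall components are small, the dominating ground state is well
  defined, and a single cell reversal cannot change it.  The two phases are exchanged by reversing
  all edges, so each has probability near \<open>1 / 2\<close> and the long trails form a bottleneck.  Reversals
  of inner cells never change the dangling edges, so that chain does not even converge.\<close>

section \<open>Bottlenecks of reversible chains\<close>

text \<open>The starting cell and the vertices of a trail determine the types along it, because type
  \<open>a\<close> is crossed along one diagonal and type \<open>b\<close> along the other. The set
  of edges to reverse therefore depends on the trail alone, and for a fixed trail the reversal is
  injective. Taking a longest trail replaces a topological description of contours. An inner cell
  can have wall degree 4, so a trail may pass through a cell twice. Boundary cells impose no parity,
  which is why open trails ending there cause no difficulty. The scale \<open>n div 3\<close> comes
  from the phase, which can be read off from the left side as well as from the right side. Walls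
  attached to a side stay within \<open>L\<close> columns of it, so if \<open>2 * L < n\<close>
  every cell is too far from one of the sides to influence the reading there. Starting cells and
  lengths are only polynomially many and cost little against an exponentially small weight.\<close>

lemma matrix_power_nonneg:
  assumes "\<And>x y. x \<in> S \<Longrightarrow> y \<in> S \<Longrightarrow> 0 \<le> P x y" "x \<in> S" "y \<in> S"
  shows "0 \<le> matrix_power S P t x y"
  using assms(2)
    by (induction t arbitrary: x) (auto intro!: sum_nonneg mult_nonneg_nonneg assms(1,3))

lemma matrix_power_row_sum:
  assumes "finite S" "\<And>x. x \<in> S \<Longrightarrow> (\<Sum>y\<in>S. P x y) = 1" "x \<in> S"
  shows "(\<Sum>y\<in>S. matrix_power S P t x y) = 1"
  using assms(3)
proof (induction t arbitrary: x)
  case 0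
  then show ?case using assms(1) by (simp add: of_bool_def)
next
  case (Suc t)
  have "(\<Sum>y\<in>S. matrix_power S P (Suc t) x y) = (\<Sum>z\<in>S. \<Sum>y\<in>S. P x z * matrix_power S P t z y)"
    unfolding matrix_power.simps by (rule sum.swap)
  also have "\<dots> = (\<Sum>z\<in>S. P x z * 1)"
    by (rule sum.cong) (auto simp: sum_distrib_left[symmetric] Suc.IH)
  finally show ?case using assms(2) Suc.prems by simp
qed

text \<open>Both functions have total 1, so their differences on \<open>B\<close> and on the
  complement of \<open>B\<close> are opposite; the two contributions cancel the factor 1/2.\<close>

lemma tv_dist_ge:
  assumes "finite S" "B \<subseteq> S" "sum \<mu> S = 1" "sum \<nu> S = 1"
  shows "sum \<nu> B - sum \<mu> B \<le> tv_dist S \<mu> \<nu>"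
proof -
  have split: "sum h S = sum h B + sum h (S - B)" for h :: "'a \<Rightarrow> real"
    using assms(1,2) by (metis add.commute sum.subset_diff)
  have 1: "sum \<nu> B - sum \<mu> B \<le> (\<Sum>y\<in>B. \<bar>\<mu> y - \<nu> y\<bar>)"
    by (simp add: sum_subtractf[symmetric] sum_mono)
  have 2: "sum \<mu> (S - B) - sum \<nu> (S - B) \<le> (\<Sum>y\<in>S - B. \<bar>\<mu> y - \<nu> y\<bar>)"
    by (simp add: sum_subtractf[symmetric] sum_mono)
  show ?thesis
    unfolding tv_dist_def using 1 2 split[of \<mu>] split[of \<nu>] split[of "\<lambda>y. \<bar>\<mu> y - \<nu> y\<bar>"] assms(3,4)
    by simp
qed

text \<open>A chain started in \<open>A\<close> has to visit \<open>C\<close> before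
  \<open>B\<close>. Under the stationary law each step brings at most the mass of \<open>C\<close>
  into \<open>C\<close>, which bounds the mass carried from \<open>A\<close> to \<open>B\<close> in
  \<open>t\<close> steps; being mixed at time \<open>t\<close> demands at least
  \<open>sum \<pi> B - \<epsilon>\<close> from every start in \<open>A\<close>.\<close>

lemma bottleneck:
  fixes P :: "'s \<Rightarrow> 's \<Rightarrow> real" and \<pi> :: "'s \<Rightarrow> real"
  assumes fin: "finite S"
    and P_nonneg: "\<And>x y. x \<in> S \<Longrightarrow> y \<in> S \<Longrightarrow> 0 \<le> P x y"
    and P_sum: "\<And>x. x \<in> S \<Longrightarrow> (\<Sum>y\<in>S. P x y) = 1"
    and reversible: "\<And>x y. x \<in> S \<Longrightarrow> y \<in> S \<Longrightarrow> \<pi> x * P x y = \<pi> y * P y x"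
    and \<pi>_nonneg: "\<And>x. x \<in> S \<Longrightarrow> 0 \<le> \<pi> x"
    and \<pi>_sum: "sum \<pi> S = 1"
    and S: "S = A \<union> C \<union> B" "A \<inter> C = {}" "(A \<union> C) \<inter> B = {}"
    and sep: "\<And>x y. x \<in> A \<Longrightarrow> y \<in> B \<Longrightarrow> P x y = 0"
    and mix: "\<And>x. x \<in> A \<Longrightarrow> tv_dist S (matrix_power S P t x) \<pi> \<le> \<epsilon>"
  shows "sum \<pi> A * (sum \<pi> B - \<epsilon>) \<le> real t * sum \<pi> C"
proof -
  define u where "u t x = (\<Sum>y\<in>B. matrix_power S P t x y)" for t x
  have finite: "finite A" "finite B" "finite C" and sub: "A \<subseteq> S" "B \<subseteq> S" "C \<subseteq> S"
    using fin S(1) by auto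
  have u_nonneg: "0 \<le> u t x" if "x \<in> S" for t x
    unfolding u_def using sub by (intro sum_nonneg matrix_power_nonneg P_nonneg) (use that in auto)
  have u_le1: "u t x \<le> 1" if "x \<in> S" for t x
  proof -
    have "u t x \<le> (\<Sum>y\<in>S. matrix_power S P t x y)"
      unfolding u_def using fin sub that
      by (intro sum_mono2) (auto intro!: matrix_power_nonneg P_nonneg)
    then show ?thesis using matrix_power_row_sum[OF fin P_sum that] by simp
  qed
  have stationary: "(\<Sum>x\<in>A. \<pi> x * P x z) \<le> \<pi> z" if "z \<in> S" for z
  proof -
    have "(\<Sum>x\<in>A. \<pi> x * P x z) \<le> (\<Sum>x\<in>S. \<pi> x * P x z)"
      using fin sub that by (intro sum_mono2) (auto intro!: mult_nonneg_nonneg \<pi>_nonneg P_nonneg)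
    also have "\<dots> = (\<Sum>x\<in>S. \<pi> z * P z x)"
      by (rule sum.cong) (use reversible that in auto)
    also have "\<dots> = \<pi> z" using P_sum that by (simp add: sum_distrib_left[symmetric])
    finally show ?thesis .
  qed
  \<comment> \<open>Mass that enters \<open>C\<close> is given up entirely, by bounding
    \<open>u\<close> by 1 there; mass that stays in \<open>A\<close> is handled by
    induction.\<close>
  have flow: "(\<Sum>x\<in>A. \<pi> x * u t x) \<le> real t * sum \<pi> C" for t
  proof (induction t)
    case 0
    have "u 0 x = 0" if "x \<in> A" for x
      unfolding u_def using S that by (auto intro!: sum.neutral)
    then show ?case by simp
  next
    case (Suc t)
    have "u (Suc t) x = (\<Sum>z\<in>A \<union> C. P x z * u t z)" if "x \<in> A" for x
    proof -
      have "u (Suc t) x = (\<Sum>z\<in>S. P x z * u t z)"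
        unfolding u_def by (simp add: sum_distrib_left sum.swap[of _ B S])
      also have "\<dots> = (\<Sum>z\<in>A \<union> C. P x z * u t z)"
        using fin S sep that by (intro sum.mono_neutral_right) auto
      finally show ?thesis .
    qed
    then have "(\<Sum>x\<in>A. \<pi> x * u (Suc t) x) = (\<Sum>x\<in>A. \<Sum>z\<in>A \<union> C. \<pi> x * P x z * u t z)"
      by (simp add: sum_distrib_left mult.assoc)
    also have "\<dots> = (\<Sum>z\<in>A \<union> C. (\<Sum>x\<in>A. \<pi> x * P x z) * u t z)"
      by (subst sum.swap) (simp add: sum_distrib_right)
    also have "\<dots> \<le> (\<Sum>z\<in>A \<union> C. \<pi> z * u t z)"
      using sub by (intro sum_mono mult_right_mono stationary u_nonneg) auto
    also have "\<dots> = (\<Sum>z\<in>A. \<pi> z * u t z) + (\<Sum>z\<in>C. \<pi> z * u t z)"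
      using finite S by (intro sum.union_disjoint) auto
    also have "(\<Sum>z\<in>C. \<pi> z * u t z) \<le> (\<Sum>z\<in>C. \<pi> z * 1)"
      using sub by (intro sum_mono mult_left_mono u_le1 \<pi>_nonneg) auto
    finally show ?case using Suc.IH by (simp add: algebra_simps)
  qed
  have "sum \<pi> B - \<epsilon> \<le> u t x" if "x \<in> A" for x
  proof -
    have "sum \<pi> B - u t x \<le> tv_dist S (matrix_power S P t x) \<pi>"
      unfolding u_def
      using tv_dist_ge[OF fin sub(2) matrix_power_row_sum[OF fin P_sum] \<pi>_sum] sub that by auto
    then show ?thesis using mix[OF that] by simp
  qed
  then have "sum \<pi> A * (sum \<pi> B - \<epsilon>) \<le> (\<Sum>x\<in>A. \<pi> x * u t x)"
    unfolding sum_distrib_right using sub by (intro sum_mono mult_left_mono \<pi>_nonneg) auto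
  then show ?thesis using flow[of t] by linarith
qed

lemma mixing_time_ge:
  assumes "finite S"
    and "\<And>t. (\<And>x. x \<in> S \<Longrightarrow> tv_dist S (matrix_power S P t x) \<pi> \<le> \<epsilon>) \<Longrightarrow> r \<le> real t"
  shows "ereal r \<le> ereal_of_enat (mixing_time S P \<pi> \<epsilon>)"
proof -
  define X where "X = {t. Max ((\<lambda>x. tv_dist S (matrix_power S P t x) \<pi>) ` S) \<le> \<epsilon>}"
  have r: "r \<le> real t" if "t \<in> X" for t
  proof (rule assms(2))
    fix x assume "x \<in> S"
    then have "tv_dist S (matrix_power S P t x) \<pi> \<le> Max ((\<lambda>x. tv_dist S (matrix_power S P t x) \<pi>) ` S)"
      using assms(1) by (intro Max_ge) auto
    then show "tv_dist S (matrix_power S P t x) \<pi> \<le> \<epsilon>" using that by (simp add: X_def)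
  qed
  show ?thesis
  proof (cases "X = {}")
    \<comment> \<open>The infimum of the empty set is infinity: a chain that never mixes satisfies
      every lower bound.\<close>
    case True
    then show ?thesis by (simp add: mixing_time_def X_def[symmetric] top_enat_def)
  next
    case False
    then have "Inf (enat ` X) \<in> enat ` X"
      by (intro wellorder_InfI[of "enat (SOME t. t \<in> X)"]) (simp add: some_in_eq)
    then show ?thesis using r by (auto simp: mixing_time_def X_def[symmetric])
  qed
qed

section \<open>The Glauber chain\<close>

lemma finite_edges: "finite (edges n)"
proof -
  have "edges n \<subseteq> (\<lambda>(i, j). Hor i j) ` ({0..int n} \<times> {1..int n})
      \<union> (\<lambda>(i, j). Ver i j) ` ({1..int n} \<times> {0..int n})"
    by (auto simp: edges_def)
  then show ?thesis by (rule finite_subset) auto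
qed

lemma finite_states: "finite (states n)"
  by (rule finite_subset[of _ "Pow (edges n)"]) (auto simp: states_def finite_edges)

lemma finite_vertices: "finite (vertices n)"
  by (simp add: vertices_def)

lemma Hor_in_edges [simp]: "Hor i j \<in> edges n \<longleftrightarrow> 0 \<le> i \<and> i \<le> int n \<and> 1 \<le> j \<and> j \<le> int n"
  and Ver_in_edges [simp]: "Ver i j \<in> edges n \<longleftrightarrow> 1 \<le> i \<and> i \<le> int n \<and> 0 \<le> j \<and> j \<le> int n"
  by (auto simp: edges_def)

lemma ice_rule_iff_types:
  "card (in_edges x v) = 2 \<and> card (out_edges x v) = 2 \<longleftrightarrow> type_a x v \<or> type_b x v \<or> type_c x v"
proof (cases v)
  case (Pair i j)
  show ?thesis
    unfolding Pair
    by (cases "Hor (i - 1) j \<in> x"; cases "Hor i j \<in> x"; cases "Ver i (j - 1) \<in> x"; cases "Ver i j \<in> x")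
      (simp_all add: Int_insert_left insert_Diff_if)
qed

lemma states_iff_types:
  "x \<in> states n \<longleftrightarrow> x \<subseteq> edges n \<and> (\<forall>v\<in>vertices n. type_a x v \<or> type_b x v \<or> type_c x v)"
  by (simp add: states_def ice_rule_iff_types)

lemma edges_in_states: "edges n \<in> states n"
  by (auto simp: states_iff_types vertices_def)

lemma weight_pos:
  assumes "a > 0" "b > 0" "c > 0"
  shows "weight n a b c x > 0"
  using assms by (simp add: weight_def)

lemma partition_function_pos:
  assumes "a > 0" "b > 0" "c > 0"
  shows "(\<Sum>z\<in>states n. weight n a b c z) > 0"
  using assms edges_in_states by (intro sum_pos) (auto simp: finite_states weight_pos)

lemma boltzmann_pos:
  assumes "a > 0" "b > 0" "c > 0"
  shows "boltzmann n a b c x > 0"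
  using assms by (simp add: boltzmann_def weight_pos partition_function_pos)

lemma sum_boltzmann:
  "sum (boltzmann n a b c) A = sum (weight n a b c) A / (\<Sum>z\<in>states n. weight n a b c z)"
  by (simp add: boltzmann_def sum_divide_distrib)

lemma sum_boltzmann_states:
  assumes "a > 0" "b > 0" "c > 0"
  shows "sum (boltzmann n a b c) (states n) = 1"
  using partition_function_pos[OF assms] by (simp add: sum_boltzmann less_imp_neq[symmetric])

lemma reverse_cell_reverse_cell: "reverse_cell n (reverse_cell n x f) f = x"
  by (auto simp: reverse_cell_def Let_def)

lemma directed_cycle_reverse_cell:
  "directed_cycle n x f \<Longrightarrow> directed_cycle n (reverse_cell n x f) f"
proof -
  have "bottom_right n f \<inter> top_left n f = {}" by (cases f) auto
  then show "directed_cycle n x f \<Longrightarrow> directed_cycle n (reverse_cell n x f) f"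
    unfolding directed_cycle_def reverse_cell_def Let_def by blast
qed

text \<open>At a corner of the cell that is a vertex of the grid, both incident sides of the cell
  lie in \<open>edges n\<close>, even for a boundary cell. In a directed cycle one of them enters
  the vertex and the other leaves it, so reversing both preserves the ice rule.\<close>

lemma reverse_cell_in_states:
  assumes x: "x \<in> states n" and d: "directed_cycle n x f"
  shows "reverse_cell n x f \<in> states n"
proof -
  obtain p q where f: "f = (p, q)" by (cases f)
  define y where "y = reverse_cell n x f"
  have H: "Hor i j \<in> y \<longleftrightarrow>
      (if Hor i j \<in> edges n \<and> (i = p \<and> (j = q \<or> j = q + 1)) then Hor i j \<notin> x else Hor i j \<in> x)" for i j
    unfolding y_def by (auto simp: f reverse_cell_def Let_def)
  have V: "Ver i j \<in> y \<longleftrightarrow>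
      (if Ver i j \<in> edges n \<and> (j = q \<and> (i = p \<or> i = p + 1)) then Ver i j \<notin> x else Ver i j \<in> x)" for i j
    unfolding y_def by (auto simp: f reverse_cell_def Let_def)
  have "type_a y v \<or> type_b y v \<or> type_c y v" if "v \<in> vertices n" for v
  proof (cases v)
    case (Pair i j)
    have ij: "1 \<le> i" "i \<le> int n" "1 \<le> j" "j \<le> int n" using that by (auto simp: Pair vertices_def)
    have t: "type_a x (i, j) \<or> type_b x (i, j) \<or> type_c x (i, j)"
      using x that by (auto simp: states_iff_types Pair)
    obtain s where "\<forall>e\<in>bottom_right n f. e \<in> x \<longleftrightarrow> s" "\<forall>e\<in>top_left n f. e \<in> x \<longleftrightarrow> \<not> s"
      using d unfolding directed_cycle_def by blast
    then have s:
      "Hor p q \<in> edges n \<Longrightarrow> Hor p q \<in> x \<longleftrightarrow> s" "Ver (p + 1) q \<in> edges n \<Longrightarrow> Ver (p + 1) q \<in> x \<longleftrightarrow> s"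
      "Hor p (q + 1) \<in> edges n \<Longrightarrow> Hor p (q + 1) \<in> x \<longleftrightarrow> \<not> s" "Ver p q \<in> edges n \<Longrightarrow> Ver p q \<in> x \<longleftrightarrow> \<not> s"
      unfolding f by simp_all
    consider "i = p" "j = q" | "i = p + 1" "j = q" | "i = p" "j = q + 1" | "i = p + 1" "j = q + 1"
      | "\<not> ((i = p \<or> i = p + 1) \<and> (j = q \<or> j = q + 1))" by auto
    then show ?thesis
    proof cases
      case 1
      then have "Hor (i - 1) j \<in> y \<longleftrightarrow> Hor (i - 1) j \<in> x" "Hor i j \<in> y \<longleftrightarrow> Hor i j \<notin> x"
        "Ver i (j - 1) \<in> y \<longleftrightarrow> Ver i (j - 1) \<in> x" "Ver i j \<in> y \<longleftrightarrow> Ver i j \<notin> x"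
        using ij by (simp_all add: H V)
      then show ?thesis using t ij s(1,4) 1 unfolding Pair by auto
    next
      case 2
      then have "Hor (i - 1) j \<in> y \<longleftrightarrow> Hor (i - 1) j \<notin> x" "Hor i j \<in> y \<longleftrightarrow> Hor i j \<in> x"
        "Ver i (j - 1) \<in> y \<longleftrightarrow> Ver i (j - 1) \<in> x" "Ver i j \<in> y \<longleftrightarrow> Ver i j \<notin> x"
        using ij by (simp_all add: H V)
      then show ?thesis using t ij s(1,2) 2 unfolding Pair by auto
    next
      case 3
      then have "Hor (i - 1) j \<in> y \<longleftrightarrow> Hor (i - 1) j \<in> x" "Hor i j \<in> y \<longleftrightarrow> Hor i j \<notin> x"
        "Ver i (j - 1) \<in> y \<longleftrightarrow> Ver i (j - 1) \<notin> x" "Ver i j \<in> y \<longleftrightarrow> Ver i j \<in> x"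
        using ij by (simp_all add: H V)
      then show ?thesis using t ij s(3,4) 3 unfolding Pair by auto
    next
      case 4
      then have "Hor (i - 1) j \<in> y \<longleftrightarrow> Hor (i - 1) j \<notin> x" "Hor i j \<in> y \<longleftrightarrow> Hor i j \<in> x"
        "Ver i (j - 1) \<in> y \<longleftrightarrow> Ver i (j - 1) \<notin> x" "Ver i j \<in> y \<longleftrightarrow> Ver i j \<in> x"
        using ij by (simp_all add: H V)
      then show ?thesis using t ij s(2,3) 4 unfolding Pair by auto
    next
      case 5
      then have "Hor (i - 1) j \<in> y \<longleftrightarrow> Hor (i - 1) j \<in> x" "Hor i j \<in> y \<longleftrightarrow> Hor i j \<in> x"
        "Ver i (j - 1) \<in> y \<longleftrightarrow> Ver i (j - 1) \<in> x" "Ver i j \<in> y \<longleftrightarrow> Ver i j \<in> x"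
        unfolding H V by auto
      then show ?thesis using t unfolding Pair by simp
    qed
  qed
  moreover have "y \<subseteq> edges n"
  proof -
    have "bottom_right n f \<union> top_left n f \<subseteq> edges n" by (auto simp: f)
    then show ?thesis using x by (auto simp: y_def reverse_cell_def Let_def states_def)
  qed
  ultimately show ?thesis by (simp add: states_iff_types y_def)
qed

lemma cell_update_nonneg:
  assumes "a > 0" "b > 0" "c > 0"
  shows "0 \<le> cell_update n a b c f x y"
  using boltzmann_pos[OF assms, of n x] boltzmann_pos[OF assms, of n "reverse_cell n x f"]
  by (auto simp: cell_update_def Let_def)

lemma cell_update_row_sum:
  assumes "x \<in> states n"
  shows "(\<Sum>y\<in>states n. cell_update n a b c f x y) = 1"
proof -
  have 1: "(\<Sum>y\<in>states n. k * of_bool (y = z)) = k" if "z \<in> states n" for z and k :: real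
    using that by (simp add: of_bool_def finite_states if_distrib[of "(*) k"] cong: if_cong)
  show ?thesis
  proof (cases "directed_cycle n x f")
    case True
    then show ?thesis
      using assms by (simp add: cell_update_def Let_def sum.distrib 1 reverse_cell_in_states)
  next
    case False
    then show ?thesis using 1[of x 1] assms by (simp add: cell_update_def)
  qed
qed

text \<open>Detailed balance for the Metropolis rule: for a genuine move both sides are the minimum
  of the two probabilities, and the reverse move uses the same cell.\<close>

lemma cell_update_reversible:
  assumes "a > 0" "b > 0" "c > 0"
  shows "boltzmann n a b c x * cell_update n a b c f x y = boltzmann n a b c y * cell_update n a b c f y x"
proof (cases "directed_cycle n x f \<and> y = reverse_cell n x f \<and> x \<noteq> y")
  case True
  have p: "s * min 1 (t / s) = min s t" if "s > 0" "t > 0" for s t :: real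
    using that by (auto simp: min_def field_simps)
  from True have "x = reverse_cell n y f" "directed_cycle n y f"
    using reverse_cell_reverse_cell directed_cycle_reverse_cell by auto
  then show ?thesis using True p boltzmann_pos[OF assms]
    by (simp add: cell_update_def Let_def min.commute)
next
  case False
  show ?thesis
  proof (cases "x = y")
    case neq: False
    then have "\<not> (directed_cycle n y f \<and> x = reverse_cell n y f)"
      using False reverse_cell_reverse_cell directed_cycle_reverse_cell by metis
    then show ?thesis using False neq by (auto simp: cell_update_def Let_def)
  qed simp
qed

lemma glauber_nonneg:
  assumes "a > 0" "b > 0" "c > 0"
  shows "0 \<le> glauber C n a b c x y"
  using cell_update_nonneg[OF assms] by (simp add: glauber_def sum_nonneg)

lemma glauber_row_sum:
  assumes "finite C" "C \<noteq> {}" "x \<in> states n"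
  shows "(\<Sum>y\<in>states n. glauber C n a b c x y) = 1"
proof -
  have "(\<Sum>y\<in>states n. glauber C n a b c x y) = (\<Sum>f\<in>C. \<Sum>y\<in>states n. cell_update n a b c f x y) / real (card C)"
    by (simp add: glauber_def sum_divide_distrib[symmetric] sum.swap[of _ _ C])
  then show ?thesis using assms by (simp add: cell_update_row_sum)
qed

lemma glauber_reversible:
  assumes "a > 0" "b > 0" "c > 0"
  shows "boltzmann n a b c x * glauber C n a b c x y = boltzmann n a b c y * glauber C n a b c y x"
  by (simp add: glauber_def sum_distrib_left cell_update_reversible[OF assms])

lemma glauber_eq_0:
  assumes "x \<noteq> y" "\<And>f. f \<in> C \<Longrightarrow> directed_cycle n x f \<Longrightarrow> y \<noteq> reverse_cell n x f"
  shows "glauber C n a b c x y = 0"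
proof -
  have "cell_update n a b c f x y = 0" if "f \<in> C" for f
    using assms that by (auto simp: cell_update_def Let_def)
  then show ?thesis by (simp add: glauber_def)
qed

section \<open>Domain walls\<close>

lemma type_a_not_b: "type_a x v \<Longrightarrow> \<not> type_b x v"
  and type_a_not_c: "type_a x v \<Longrightarrow> \<not> type_c x v"
  and type_b_not_c: "type_b x v \<Longrightarrow> \<not> type_c x v"
  by (cases v; auto)+

text \<open>A domain wall runs through every vertex of type \<open>a\<close> or \<open>b\<close>: for type \<open>a\<close> it joins the
  lower left to the upper right cell at the vertex, for type \<open>b\<close> the upper left to the lower right
  one.  Then \<open>touches x f v\<close> says that the wall through \<open>v\<close> ends in the cell \<open>f\<close>, and
  \<open>opposite f v\<close> is its other end.\<close>

fun corners :: "int \<times> int \<Rightarrow> (int \<times> int) set" where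
  "corners (p, q) = {(p, q), (p + 1, q), (p, q + 1), (p + 1, q + 1)}"

fun main_diagonal :: "int \<times> int \<Rightarrow> int \<times> int \<Rightarrow> bool" where
  "main_diagonal (p, q) v \<longleftrightarrow> v = (p, q) \<or> v = (p + 1, q + 1)"

fun opposite :: "int \<times> int \<Rightarrow> int \<times> int \<Rightarrow> int \<times> int" where
  "opposite (p, q) (i, j) = (2 * i - 1 - p, 2 * j - 1 - q)"

definition touches :: "edge set \<Rightarrow> int \<times> int \<Rightarrow> int \<times> int \<Rightarrow> bool" where
  "touches x f v \<longleftrightarrow> v \<in> corners f \<and> (if main_diagonal f v then type_a x v else type_b x v)"

lemma opposite_opposite [simp]: "opposite (opposite f v) v = f"
  by (cases f; cases v) simp

lemma opposite_neq: "opposite f v \<noteq> f"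
proof -
  have "2 * i - 1 - p \<noteq> p" for i p :: int by presburger
  then show ?thesis by (cases f; cases v) auto
qed

lemma touches_opposite: "touches x f v \<Longrightarrow> touches x (opposite f v) v"
  by (cases f; cases v) (auto simp: touches_def simp del: type_a.simps type_b.simps split: if_splits)

lemma touches_cases:
  "touches x f v \<Longrightarrow> touches x g v \<Longrightarrow> g = f \<or> g = opposite f v"
  using type_a_not_b[of x v]
  by (cases f; cases g; cases v) (auto simp: touches_def simp del: type_a.simps type_b.simps split: if_splits)

lemma touches_iff:
  assumes "touches x f v"
  shows "touches x g v \<longleftrightarrow> g = f \<or> g = opposite f v"
  using assms touches_cases touches_opposite by blast

lemma sum_corners:
  "(\<Sum>v\<in>corners (p, q). h v) = h (p, q) + h (p + 1, q) + h (p, q + 1) + h (p + 1, q + 1)"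
  for h :: "int \<times> int \<Rightarrow> 'a::comm_monoid_add"
  by (simp add: add.assoc)

lemma finite_corners: "finite (corners f)"
  by (cases f) simp

lemma card_touching:
  "card {v \<in> T. touches x f v} = (\<Sum>v\<in>corners f. of_bool (v \<in> T \<and> touches x f v))"
proof -
  have "{v \<in> T. touches x f v} = corners f \<inter> {v. v \<in> T \<and> touches x f v}"
    by (auto simp: touches_def)
  then show ?thesis by (simp add: finite_corners)
qed

lemma corners_inner_cell: "f \<in> inner_cells n \<Longrightarrow> corners f \<subseteq> vertices n"
  by (cases f) (auto simp: inner_cells_def vertices_def)

text \<open>A wall at a corner ends in the cell exactly if the two sides of the cell meeting there
  have opposite senses of rotation, and the sense changes an even number of times on a tour around
  the cell. All four corners must be vertices, hence the restriction to inner cells.\<close>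

lemma even_touching_inner_cell:
  assumes x: "x \<in> states n" and f: "f \<in> inner_cells n"
  shows "even (card {v. touches x f v})"
proof -
  obtain p q where pq: "f = (p, q)" by (cases f)
  have t: "type_a x v \<or> type_b x v \<or> type_c x v" if "v \<in> corners f" for v
    using that x corners_inner_cell[OF f] by (auto simp: states_iff_types)
  have "touches x f (p, q) \<longleftrightarrow> (Hor p q \<in> x \<longleftrightarrow> Ver p q \<in> x)"
    using t[of "(p, q)"] unfolding pq touches_def by auto
  moreover have "touches x f (p + 1, q) \<longleftrightarrow> (Hor p q \<in> x \<longleftrightarrow> Ver (p + 1) q \<notin> x)"
    using t[of "(p + 1, q)"] unfolding pq touches_def by auto
  moreover have "touches x f (p, q + 1) \<longleftrightarrow> (Hor p (q + 1) \<in> x \<longleftrightarrow> Ver p q \<notin> x)"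
    using t[of "(p, q + 1)"] unfolding pq touches_def by auto
  moreover have "touches x f (p + 1, q + 1) \<longleftrightarrow> (Hor p (q + 1) \<in> x \<longleftrightarrow> Ver (p + 1) q \<in> x)"
    using t[of "(p + 1, q + 1)"] unfolding pq touches_def by auto
  ultimately show ?thesis
    using card_touching[of UNIV x f] unfolding pq sum_corners by auto
qed

text \<open>An even set of walls bounds: \<open>s\<close> is obtained by counting the walls crossed along rows,
  and evenness around the inner cells makes this consistent between adjacent rows.\<close>

lemma exists_flip:
  fixes A B :: "(int \<times> int) set"
  assumes even: "\<And>p q. (p, q) \<in> inner_cells n \<Longrightarrow>
      even (of_bool ((p, q) \<in> A) + of_bool ((p + 1, q) \<in> B) + of_bool ((p, q + 1) \<in> B)
        + of_bool ((p + 1, q + 1) \<in> A) :: nat)"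
    and disj: "A \<inter> B = {}"
  obtains s :: "edge \<Rightarrow> bool" where
    "\<And>i j. (i, j) \<in> vertices n \<Longrightarrow> s (Hor i j) = (s (Hor (i - 1) j) \<noteq> ((i, j) \<in> A \<union> B))"
    "\<And>i j. (i, j) \<in> vertices n \<Longrightarrow> s (Ver i j) = (s (Hor (i - 1) j) \<noteq> ((i, j) \<in> B))"
    "\<And>i j. (i, j) \<in> vertices n \<Longrightarrow> s (Ver i (j - 1)) = (s (Hor (i - 1) j) \<noteq> ((i, j) \<in> A))"
proof -
  \<comment> \<open>\<open>l\<close> gives the values on the left dangling edges
    \<open>Hor 0 j\<close>, chosen so that the vertices \<open>(1, j)\<close> and
    \<open>(1, j + 1)\<close> agree on the vertical edge between them; \<open>h i j\<close> then
    continues along row \<open>j\<close>.\<close>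
  define l :: "nat \<Rightarrow> bool" where
    "l = rec_nat False (\<lambda>j r. r \<noteq> (((1, int j) \<in> B) \<noteq> ((1, int (Suc j)) \<in> A)))"
  define h :: "nat \<Rightarrow> int \<Rightarrow> bool" where
    "h = (\<lambda>i j. rec_nat (l (nat j)) (\<lambda>i r. r \<noteq> ((int (Suc i), j) \<in> A \<union> B)) i)"
  \<comment> \<open>A vertical edge takes its value from its lower vertex, except in the bottom row
    of dangling edges, which have only an upper one.\<close>
  define s :: "edge \<Rightarrow> bool" where
    "s e = (case e of Hor i j \<Rightarrow> h (nat i) j
      | Ver i j \<Rightarrow> if j = 0 then h (nat (i - 1)) 1 \<noteq> ((i, 1) \<in> A) else h (nat (i - 1)) j \<noteq> ((i, j) \<in> B))"
    for e
  have h_Suc: "h (Suc i) j = (h i j \<noteq> ((int (Suc i), j) \<in> A \<union> B))" for i j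
    by (simp add: h_def)
  have parity: "even (of_bool P + of_bool Q + of_bool R + of_bool S :: nat) \<longleftrightarrow> (P = Q) = (R = S)" for P Q R S
    by (cases P; cases Q; cases R; cases S) simp_all
  \<comment> \<open>The lower and the upper vertex of a vertical edge prescribe the same value;
    evenness at the inner cell carries this one column further.\<close>
  have key: "(h i j \<noteq> ((int i + 1, j) \<in> B)) = (h i (j + 1) \<noteq> ((int i + 1, j + 1) \<in> A))"
    if "i < n" "1 \<le> j" "j < int n" for i j
    using that(1)
  proof (induction i)
    case 0
    have "nat (j + 1) = Suc (nat j)" using that(2) by simp
    then show ?case using that(2) by (auto simp: h_def l_def add.commute)
  next
    case (Suc i)
    have "(int i + 1, j) \<in> inner_cells n" using Suc.prems that by (auto simp: inner_cells_def)
    from even[OF this] have ev: "(((int i + 1, j) \<in> A) = ((int i + 2, j) \<in> B))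
        = (((int i + 1, j + 1) \<in> B) = ((int i + 2, j + 1) \<in> A))"
      unfolding parity by (simp add: add.assoc)
    have nA: "\<not> ((int i + 1, j) \<in> A \<and> (int i + 1, j) \<in> B)"
      "\<not> ((int i + 1, j + 1) \<in> A \<and> (int i + 1, j + 1) \<in> B)" using disj by auto
    have IH: "(h i j \<noteq> ((int i + 1, j) \<in> B)) = (h i (j + 1) \<noteq> ((int i + 1, j + 1) \<in> A))"
      using Suc by simp
    have Suc_i: "int (Suc i) = int i + 1" "int i + 1 + 1 = int i + 2" by simp_all
    show ?case using ev nA IH unfolding h_Suc Suc_i Un_iff by argo
  qed
  show thesis
  proof
    fix i j assume "(i, j) \<in> vertices n"
    then have ij: "1 \<le> i" "i \<le> int n" "1 \<le> j" "j \<le> int n" by (auto simp: vertices_def)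
    have i: "nat i = Suc (nat (i - 1))" using ij by simp
    then show "s (Hor i j) = (s (Hor (i - 1) j) \<noteq> ((i, j) \<in> A \<union> B))"
      using ij by (simp add: s_def h_Suc)
    show "s (Ver i j) = (s (Hor (i - 1) j) \<noteq> ((i, j) \<in> B))"
      using ij by (simp add: s_def)
    show "s (Ver i (j - 1)) = (s (Hor (i - 1) j) \<noteq> ((i, j) \<in> A))"
      using ij key[of "nat (i - 1)" "j - 1"] by (cases "j = 1") (auto simp: s_def)
  qed
qed

section \<open>Weights, and trails along walls\<close>

definition vertex_weight :: "real \<Rightarrow> real \<Rightarrow> real \<Rightarrow> edge set \<Rightarrow> int \<times> int \<Rightarrow> real" where
  "vertex_weight a b c x v = (if type_a x v then a else if type_b x v then b else c)"

lemma weight_eq_prod: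
  assumes "x \<in> states n"
  shows "weight n a b c x = (\<Prod>v\<in>vertices n. vertex_weight a b c x v)"
proof -
  have "vertex_weight a b c x v = (if type_a x v then a else 1) * (if type_b x v then b else 1)
      * (if type_c x v then c else 1)" if "v \<in> vertices n" for v
    using assms that type_a_not_b[of x v] type_a_not_c[of x v] type_b_not_c[of x v]
    by (auto simp: states_iff_types vertex_weight_def)
  then have "(\<Prod>v\<in>vertices n. vertex_weight a b c x v) = (\<Prod>v\<in>vertices n.
      (if type_a x v then a else 1) * (if type_b x v then b else 1) * (if type_c x v then c else 1))"
    by (rule prod.cong[OF refl])
  then show ?thesis
    by (simp add: weight_def prod.distrib finite_vertices prod.inter_filter[symmetric])
qed

text \<open>At a vertex of \<open>A\<close> the left and top edges or the right and bottom edges are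
  reversed, at a vertex of \<open>B\<close> the left and bottom or the right and top edges.
  Everywhere else all four edges are reversed or none, and each type is invariant under reversing
  all four.\<close>

lemma flip_types:
  fixes s :: "edge \<Rightarrow> bool"
  assumes v: "(i, j) \<in> vertices n"
    and s: "s (Hor i j) = (s (Hor (i - 1) j) \<noteq> ((i, j) \<in> A \<union> B))"
      "s (Ver i j) = (s (Hor (i - 1) j) \<noteq> ((i, j) \<in> B))"
      "s (Ver i (j - 1)) = (s (Hor (i - 1) j) \<noteq> ((i, j) \<in> A))"
    and y: "y = {e \<in> edges n. (e \<in> x) \<noteq> s e}"
    and A: "(i, j) \<in> A \<Longrightarrow> type_a x (i, j)" and B: "(i, j) \<in> B \<Longrightarrow> type_b x (i, j)"
  shows "(i, j) \<in> A \<union> B \<Longrightarrow> type_c y (i, j)"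
    and "(i, j) \<notin> A \<union> B \<Longrightarrow> type_a y (i, j) = type_a x (i, j)"
    and "(i, j) \<notin> A \<union> B \<Longrightarrow> type_b y (i, j) = type_b x (i, j)"
    and "(i, j) \<notin> A \<union> B \<Longrightarrow> type_c y (i, j) = type_c x (i, j)"
proof -
  have ij: "1 \<le> i" "i \<le> int n" "1 \<le> j" "j \<le> int n" using v by (auto simp: vertices_def)
  have m: "Hor (i - 1) j \<in> y \<longleftrightarrow> (Hor (i - 1) j \<in> x) \<noteq> s (Hor (i - 1) j)"
    "Hor i j \<in> y \<longleftrightarrow> (Hor i j \<in> x) \<noteq> s (Hor i j)"
    "Ver i (j - 1) \<in> y \<longleftrightarrow> (Ver i (j - 1) \<in> x) \<noteq> s (Ver i (j - 1))"
    "Ver i j \<in> y \<longleftrightarrow> (Ver i j \<in> x) \<noteq> s (Ver i j)"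
    using ij by (simp_all add: y)
  show "(i, j) \<in> A \<union> B \<Longrightarrow> type_c y (i, j)"
    using A B type_a_not_b[of x "(i, j)"] by (auto simp: m s)
  show "(i, j) \<notin> A \<union> B \<Longrightarrow> type_a y (i, j) = type_a x (i, j)"
    "(i, j) \<notin> A \<union> B \<Longrightarrow> type_b y (i, j) = type_b x (i, j)"
    "(i, j) \<notin> A \<union> B \<Longrightarrow> type_c y (i, j) = type_c x (i, j)"
    by (auto simp: m s)
qed

text \<open>A walk from cell to cell along walls, recorded by its starting cell and the vertices it
  crosses. The cells visited are recovered by folding \<open>opposite\<close>, so the walk ends in
  \<open>foldl opposite f vs\<close>.\<close>

fun path :: "nat \<Rightarrow> edge set \<Rightarrow> int \<times> int \<Rightarrow> (int \<times> int) list \<Rightarrow> bool" where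
  "path n x f [] \<longleftrightarrow> True"
| "path n x f (v # vs) \<longleftrightarrow> v \<in> vertices n \<and> touches x f v \<and> path n x (opposite f v) vs"

lemma path_append: "path n x f (vs @ ws) \<longleftrightarrow> path n x f vs \<and> path n x (foldl opposite f vs) ws"
  by (induction vs arbitrary: f) auto

text \<open>The diagonal along which a vertex is crossed fixes its type. This is what lets one
  reversal serve all states that share a trail.\<close>

lemma path_types_eq:
  assumes "path n x f vs" "path n y f vs" "v \<in> set vs"
  shows "type_a x v \<longleftrightarrow> type_a y v" "type_b x v \<longleftrightarrow> type_b y v"
proof -
  have "(type_a x v \<and> type_a y v) \<or> (type_b x v \<and> type_b y v)"
    using assms by (induction vs arbitrary: f) (auto simp: touches_def split: if_splits)
  then show "type_a x v \<longleftrightarrow> type_a y v" "type_b x v \<longleftrightarrow> type_b y v"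
    using type_a_not_b by blast+
qed

lemma path_types:
  "path n x f vs \<Longrightarrow> v \<in> set vs \<Longrightarrow> v \<in> vertices n \<and> (type_a x v \<or> type_b x v)"
  by (induction vs arbitrary: f) (auto simp: touches_def split: if_splits)

fun path_weight :: "real \<Rightarrow> real \<Rightarrow> int \<times> int \<Rightarrow> (int \<times> int) list \<Rightarrow> real" where
  "path_weight \<alpha> \<beta> f [] = 1"
| "path_weight \<alpha> \<beta> f (v # vs) = (if main_diagonal f v then \<alpha> else \<beta>) * path_weight \<alpha> \<beta> (opposite f v) vs"

lemma path_weight_eq_prod:
  assumes "path n x f vs" "distinct vs"
  shows "path_weight \<alpha> \<beta> f vs = (\<Prod>v\<in>set vs. if type_a x v then \<alpha> else \<beta>)"
  using assms
proof (induction vs arbitrary: f)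
  case (Cons v vs)
  then have "main_diagonal f v \<longleftrightarrow> type_a x v"
    using type_a_not_b[of x v] by (auto simp: touches_def split: if_splits)
  then show ?case using Cons by simp
qed simp

text \<open>Each vertex carries at most one wall, so distinct vertices mean that no wall is used
  twice; cells may be revisited.\<close>

definition trail :: "nat \<Rightarrow> edge set \<Rightarrow> int \<times> int \<Rightarrow> (int \<times> int) list \<Rightarrow> bool" where
  "trail n x f vs \<longleftrightarrow> path n x f vs \<and> distinct vs"

text \<open>The maximum runs over all starting cells, since prolonging a trail at its front changes
  its start.\<close>

definition longest_trail :: "nat \<Rightarrow> edge set \<Rightarrow> int \<times> int \<Rightarrow> (int \<times> int) list \<Rightarrow> bool" where
  "longest_trail n x f vs \<longleftrightarrow> trail n x f vs \<and> (\<forall>g ws. trail n x g ws \<longrightarrow> length ws \<le> length vs)"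

text \<open>Handshake argument: each wall counts once at each of its two end cells, so only the two
  ends of the trail have odd degree, and if they coincide no cell has.\<close>

lemma even_trail_degree:
  assumes "path n x f vs" "distinct vs"
  shows "even (card {v \<in> set vs. touches x g v}) \<longleftrightarrow> (g = f \<longleftrightarrow> g = foldl opposite f vs)"
  using assms
proof (induction vs arbitrary: f)
  case (Cons v vs)
  have IH: "even (card {v \<in> set vs. touches x g v}) \<longleftrightarrow>
      (g = opposite f v \<longleftrightarrow> g = foldl opposite (opposite f v) vs)"
    using Cons by simp
  have t: "touches x g v \<longleftrightarrow> g = f \<or> g = opposite f v"
    using Cons.prems touches_iff by simp
  have "{w \<in> set (v # vs). touches x g w} =
      (if touches x g v then insert v {w \<in> set vs. touches x g w} else {w \<in> set vs. touches x g w})"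
    by auto
  then have "card {w \<in> set (v # vs). touches x g w} =
      of_bool (touches x g v) + card {w \<in> set vs. touches x g w}"
    using Cons.prems by simp
  then show ?case using IH t opposite_neq[of f v] by (auto split: if_splits)
qed simp

text \<open>At a cell of odd degree the trail could be prolonged, because the total wall degree of an
  inner cell is even.\<close>

lemma longest_trail_even:
  assumes x: "x \<in> states n" and l: "longest_trail n x f vs" and g: "g \<in> inner_cells n"
  shows "even (card {v \<in> set vs. touches x g v})"
proof (rule ccontr)
  assume odd: "odd (card {v \<in> set vs. touches x g v})"
  have p: "path n x f vs" "distinct vs" and max: "\<And>h ws. trail n x h ws \<Longrightarrow> length ws \<le> length vs"
    using l by (auto simp: longest_trail_def trail_def)
  have "{v \<in> set vs. touches x g v} \<noteq> {v. touches x g v}"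
    using odd even_touching_inner_cell[OF x g] by auto
  then obtain v where v: "touches x g v" "v \<notin> set vs" by auto
  then have vn: "v \<in> vertices n" using corners_inner_cell[OF g] by (auto simp: touches_def)
  have "g = f \<or> g = foldl opposite f vs" using odd even_trail_degree[OF p, of g] by auto
  then show False
  proof
    assume "g = f"
    then have "trail n x (opposite f v) (v # vs)"
      using p v vn touches_opposite by (simp add: trail_def)
    then show False using max by fastforce
  next
    assume "g = foldl opposite f vs"
    then have "trail n x f (vs @ [v])"
      using p v vn by (simp add: trail_def path_append)
    then show False using max by fastforce
  qed
qed

text \<open>Reversing all edges on one side of the trail turns exactly its vertices into type \<open>c\<close>.\<close>

lemma sum_weight_longest_trail_le:
  assumes pos: "a > 0" "b > 0" "c > 0"
  shows "(\<Sum>x | x \<in> states n \<and> longest_trail n x f vs. weight n a b c x)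
    \<le> path_weight (a / c) (b / c) f vs * (\<Sum>x\<in>states n. weight n a b c x)"
proof -
  define X where "X = {x. x \<in> states n \<and> longest_trail n x f vs}"
  have "sum (weight n a b c) X \<le> path_weight (a / c) (b / c) f vs * (\<Sum>x\<in>states n. weight n a b c x)"
  proof (cases "X = {}")
    case True
    have "path_weight (a / c) (b / c) f vs \<ge> 0" for f
      using pos by (induction vs arbitrary: f) auto
    then show ?thesis using True partition_function_pos[OF pos, of n]
      by (simp add: mult_nonneg_nonneg)
  next
    case False
    then obtain x0 where x0: "x0 \<in> states n" "longest_trail n x0 f vs" by (auto simp: X_def)
    then have p0: "path n x0 f vs" and dist: "distinct vs"
      by (auto simp: longest_trail_def trail_def)
    \<comment> \<open>\<open>A\<close> and \<open>B\<close> are read off from the single state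
      \<open>x0\<close>, but they are the same for all states in \<open>X\<close>. Hence
      \<open>flip\<close> is the symmetric difference with one fixed set of edges, which makes it
      injective.\<close>
    define A where "A = {v \<in> set vs. type_a x0 v}"
    define B where "B = {v \<in> set vs. type_b x0 v}"
    have AB: "A \<inter> B = {}" using type_a_not_b by (auto simp: A_def B_def)
    have "even (of_bool ((p, q) \<in> A) + of_bool ((p + 1, q) \<in> B) + of_bool ((p, q + 1) \<in> B)
        + of_bool ((p + 1, q + 1) \<in> A) :: nat)" if "(p, q) \<in> inner_cells n" for p q
      using longest_trail_even[OF x0 that]
      unfolding card_touching sum_corners
        by (simp add: touches_def A_def B_def del: type_a.simps type_b.simps)
    from exists_flip[OF this AB] obtain s where s:
      "\<And>i j. (i, j) \<in> vertices n \<Longrightarrow> s (Hor i j) = (s (Hor (i - 1) j) \<noteq> ((i, j) \<in> A \<union> B))"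
      "\<And>i j. (i, j) \<in> vertices n \<Longrightarrow> s (Ver i j) = (s (Hor (i - 1) j) \<noteq> ((i, j) \<in> B))"
      "\<And>i j. (i, j) \<in> vertices n \<Longrightarrow> s (Ver i (j - 1)) = (s (Hor (i - 1) j) \<noteq> ((i, j) \<in> A))"
      by blast
    define flip where "flip x = {e \<in> edges n. (e \<in> x) \<noteq> s e}" for x
    have px: "path n x f vs" "x \<in> states n" if "x \<in> X" for x
      using that by (auto simp: X_def longest_trail_def trail_def)
    have inj: "inj_on flip X"
    proof (rule inj_onI)
      fix x y assume "x \<in> X" "y \<in> X" and eq: "flip x = flip y"
      then have sub: "x \<subseteq> edges n" "y \<subseteq> edges n" by (auto simp: X_def states_def)
      have "e \<in> x \<longleftrightarrow> e \<in> y" if "e \<in> edges n" for e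
        using that eq unfolding flip_def set_eq_iff by blast
      then show "x = y" using sub by blast
    qed
    have ty: "(v \<in> A \<union> B \<longrightarrow> type_c (flip x) v) \<and> (v \<notin> A \<union> B \<longrightarrow> type_a (flip x) v = type_a x v \<and>
        type_b (flip x) v = type_b x v \<and> type_c (flip x) v = type_c x v)"
      if x: "x \<in> X" and v: "v \<in> vertices n" for x v
    proof (cases v)
      case (Pair i j)
      have "(i, j) \<in> A \<Longrightarrow> type_a x (i, j)" "(i, j) \<in> B \<Longrightarrow> type_b x (i, j)"
        using path_types_eq[OF px(1)[OF x] p0] unfolding A_def B_def by blast+
      from flip_types[OF _ s flip_def[of x] this] show ?thesis
        using v unfolding Pair by blast
    qed
    have flip_states: "flip x \<in> states n" if x: "x \<in> X" for x
    proof -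
      have "type_a (flip x) v \<or> type_b (flip x) v \<or> type_c (flip x) v" if v: "v \<in> vertices n" for v
        using ty[OF x v] px(2)[OF x] v unfolding states_iff_types by blast
      then show ?thesis by (auto simp: states_iff_types flip_def)
    qed
    have AB_set: "A \<union> B = set vs"
      using path_types[OF p0] by (auto simp: A_def B_def)
    have sub: "set vs \<subseteq> vertices n" using path_types[OF p0] by auto
    \<comment> \<open>The weight changes only at the vertices of the trail, by a factor
      \<open>a / c\<close> or \<open>b / c\<close> at each.\<close>
    have w: "weight n a b c x = path_weight (a / c) (b / c) f vs * weight n a b c (flip x)" if x: "x \<in> X" for x
    proof -
      have "vertex_weight a b c x v =
          (if v \<in> set vs then if type_a x v then a / c else b / c else 1) * vertex_weight a b c (flip x) v"
        if v: "v \<in> vertices n" for v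
      proof (cases "v \<in> set vs")
        case True
        then have "type_c (flip x) v" using ty[OF x v] AB_set by blast
        moreover have "type_a x v \<or> type_b x v" using path_types[OF px(1)[OF x] True] by simp
        ultimately show ?thesis using True pos type_a_not_c[of "flip x" v] type_b_not_c[of "flip x" v]
          by (auto simp: vertex_weight_def)
      next
        case False
        then show ?thesis using ty[OF x v] AB_set by (simp add: vertex_weight_def)
      qed
      then have "weight n a b c x = (\<Prod>v\<in>vertices n.
          (if v \<in> set vs then if type_a x v then a / c else b / c else 1) * vertex_weight a b c (flip x) v)"
        unfolding weight_eq_prod[OF px(2)[OF x]] by (rule prod.cong[OF refl])
      also have "\<dots> = (\<Prod>v\<in>vertices n. if v \<in> set vs then if type_a x v then a / c else b / c else 1)
          * weight n a b c (flip x)"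
        by (simp only: prod.distrib weight_eq_prod[OF flip_states[OF x]])
      also have "(\<Prod>v\<in>vertices n. if v \<in> set vs then if type_a x v then a / c else b / c else 1)
          = (\<Prod>v\<in>vertices n \<inter> set vs. if type_a x v then a / c else b / c)"
        by (rule prod.inter_restrict[symmetric]) (rule finite_vertices)
      also have "vertices n \<inter> set vs = set vs" using sub by auto
      also have "(\<Prod>v\<in>set vs. if type_a x v then a / c else b / c) = path_weight (a / c) (b / c) f vs"
        by (rule path_weight_eq_prod[OF px(1)[OF x] dist, symmetric])
      finally show ?thesis .
    qed
    have nonneg: "path_weight (a / c) (b / c) f vs \<ge> 0" for f
      using pos by (induction vs arbitrary: f) auto
    have "sum (weight n a b c) X = path_weight (a / c) (b / c) f vs * (\<Sum>x\<in>X. weight n a b c (flip x))"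
      unfolding sum_distrib_left by (rule sum.cong) (use w in auto)
    also have "(\<Sum>x\<in>X. weight n a b c (flip x)) = sum (weight n a b c) (flip ` X)"
      by (simp add: sum.reindex[OF inj])
    also have "path_weight (a / c) (b / c) f vs * \<dots>
        \<le> path_weight (a / c) (b / c) f vs * (\<Sum>x\<in>states n. weight n a b c x)"
      using flip_states by (intro mult_left_mono sum_mono2 nonneg)
        (auto simp: finite_states weight_pos[OF pos] less_imp_le)
    finally show ?thesis .
  qed
  then show ?thesis by (simp add: X_def)
qed

section \<open>Long trails are unlikely\<close>

text \<open>Here \<open>u\<close> is the vertex just crossed. Forbidding only it, instead of all
  earlier vertices, gives a superset of the trails whose total weight is controlled by a 2 by 2
  transfer matrix.\<close>

fun nonbacktracking :: "nat \<Rightarrow> int \<times> int \<Rightarrow> int \<times> int \<Rightarrow> (int \<times> int) list set" where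
  "nonbacktracking 0 f u = {[]}"
| "nonbacktracking (Suc l) f u =
     (\<lambda>(v, vs). v # vs) ` (SIGMA v:corners f - {u}. nonbacktracking l (opposite f v) v)"

lemma finite_nonbacktracking: "finite (nonbacktracking l f u)"
  by (induction l f u rule: nonbacktracking.induct) (auto simp: finite_corners)

lemma trail_nonbacktracking:
  "trail n x f vs \<Longrightarrow> u \<notin> set vs \<Longrightarrow> vs \<in> nonbacktracking (length vs) f u"
  by (induction vs arbitrary: f u) (auto simp: trail_def touches_def image_iff)

lemma sum_nonbacktracking_Suc:
  "(\<Sum>vs\<in>nonbacktracking (Suc l) f u. path_weight \<alpha> \<beta> f vs) =
   (\<Sum>v\<in>corners f - {u}. (if main_diagonal f v then \<alpha> else \<beta>)
      * (\<Sum>vs\<in>nonbacktracking l (opposite f v) v. path_weight \<alpha> \<beta> (opposite f v) vs))"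
proof -
  have "(\<Sum>vs\<in>nonbacktracking (Suc l) f u. path_weight \<alpha> \<beta> f vs) =
      (\<Sum>(v, vs)\<in>(SIGMA v:corners f - {u}. nonbacktracking l (opposite f v) v). path_weight \<alpha> \<beta> f (v # vs))"
    unfolding nonbacktracking.simps by (subst sum.reindex) (auto simp: inj_on_def intro!: sum.cong)
  also have "\<dots> = (\<Sum>v\<in>corners f - {u}. \<Sum>vs\<in>nonbacktracking l (opposite f v) v. path_weight \<alpha> \<beta> f (v # vs))"
    by (rule sum.Sigma[symmetric]) (auto simp: finite_corners finite_nonbacktracking)
  also have "\<dots> = (\<Sum>v\<in>corners f - {u}. (if main_diagonal f v then \<alpha> else \<beta>)
      * (\<Sum>vs\<in>nonbacktracking l (opposite f v) v. path_weight \<alpha> \<beta> (opposite f v) vs))"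
    by (simp add: sum_distrib_left)
  finally show ?thesis .
qed

lemma opposite_corner:
  "v \<in> corners f \<Longrightarrow> v \<in> corners (opposite f v)"
  "v \<in> corners f \<Longrightarrow> main_diagonal (opposite f v) v = main_diagonal f v"
  by (cases f; cases v; auto)+

text \<open>\<open>(h\<^sub>a, h\<^sub>b)\<close> is a positive supersolution, with rate \<open>r\<close>, for the transfer matrix of
  non-backtracking diagonal walks: a step can be followed by one step along the same diagonal and
  two along the other.  A rate below \<open>1\<close> exists iff \<open>(1 - \<alpha>) (1 - \<beta>) > 4 \<alpha> \<beta>\<close> (for \<open>\<alpha>, \<beta> < 1\<close>), which is
  \<open>\<alpha> + \<beta> + 3 \<alpha> \<beta> < 1\<close>.\<close>

locale transfer_matrix =
  fixes \<alpha> \<beta> h\<^sub>a h\<^sub>b r :: real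
  assumes pos: "\<alpha> > 0" "\<beta> > 0" "r > 0" "h\<^sub>a \<ge> 1" "h\<^sub>b \<ge> 1"
    and super_a: "\<alpha> * h\<^sub>a + 2 * (\<beta> * h\<^sub>b) \<le> r * h\<^sub>a"
    and super_b: "2 * (\<alpha> * h\<^sub>a) + \<beta> * h\<^sub>b \<le> r * h\<^sub>b"
begin

lemma sum_nonbacktracking_corner:
  assumes "u \<in> corners f"
  shows "(\<Sum>vs\<in>nonbacktracking l f u. path_weight \<alpha> \<beta> f vs) \<le> (if main_diagonal f u then h\<^sub>a else h\<^sub>b) * r ^ l"
  using assms
proof (induction l arbitrary: f u)
  case 0
  then show ?case using pos by simp
next
  case (Suc l)
  obtain p q where f: "f = (p, q)" by (cases f)
  define k where "k v = (if main_diagonal f v then \<alpha> * h\<^sub>a else \<beta> * h\<^sub>b)" for v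
  have "(\<Sum>vs\<in>nonbacktracking (Suc l) f u. path_weight \<alpha> \<beta> f vs) \<le> (\<Sum>v\<in>corners f - {u}. k v * r ^ l)"
    unfolding sum_nonbacktracking_Suc
  proof (rule sum_mono)
    fix v assume "v \<in> corners f - {u}"
    then show "(if main_diagonal f v then \<alpha> else \<beta>)
      * (\<Sum>vs\<in>nonbacktracking l (opposite f v) v. path_weight \<alpha> \<beta> (opposite f v) vs) \<le> k v * r ^ l"
      using Suc.IH[of v "opposite f v"] pos by (auto simp: opposite_corner k_def)
  qed
  also have "\<dots> = (\<Sum>v\<in>corners f - {u}. k v) * r ^ l" by (simp add: sum_distrib_right)
  also have "(\<Sum>v\<in>corners f - {u}. k v) = (\<Sum>v\<in>corners f. k v) - k u"
    using Suc.prems by (simp add: sum_diff1 finite_corners)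
  also have "\<dots> = 2 * (\<alpha> * h\<^sub>a) + 2 * (\<beta> * h\<^sub>b) - k u"
    unfolding f sum_corners by (simp add: k_def f)
  also have "\<dots> \<le> r * (if main_diagonal f u then h\<^sub>a else h\<^sub>b)"
    using super_a super_b by (simp add: k_def)
  finally show ?case using pos by (simp add: mult_right_mono mult.assoc mult.left_commute)
qed

text \<open>For arbitrary \<open>u\<close> the first step may use all four corners. The sum of the
  two supersolution inequalities bounds three times
  \<open>\<alpha> * h\<^sub>a + \<beta> * h\<^sub>b\<close>, which covers the two corners on each
  diagonal.\<close>

lemma sum_nonbacktracking:
  "(\<Sum>vs\<in>nonbacktracking l f u. path_weight \<alpha> \<beta> f vs) \<le> (h\<^sub>a + h\<^sub>b) * r ^ l"
proof (cases l)
  case 0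
  then show ?thesis using pos by simp
next
  case (Suc m)
  obtain p q where f: "f = (p, q)" by (cases f)
  define k where "k v = (if main_diagonal f v then \<alpha> * h\<^sub>a else \<beta> * h\<^sub>b)" for v
  have k0: "k v \<ge> 0" for v using pos by (simp add: k_def)
  have "(\<Sum>vs\<in>nonbacktracking (Suc m) f u. path_weight \<alpha> \<beta> f vs) \<le> (\<Sum>v\<in>corners f - {u}. k v * r ^ m)"
    unfolding sum_nonbacktracking_Suc
  proof (rule sum_mono)
    fix v assume "v \<in> corners f - {u}"
    then show "(if main_diagonal f v then \<alpha> else \<beta>)
      * (\<Sum>vs\<in>nonbacktracking m (opposite f v) v. path_weight \<alpha> \<beta> (opposite f v) vs) \<le> k v * r ^ m"
      using sum_nonbacktracking_corner[of v "opposite f v" m] pos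
        by (auto simp: opposite_corner k_def)
  qed
  also have "\<dots> \<le> (\<Sum>v\<in>corners f. k v * r ^ m)"
    using k0 pos by (intro sum_mono2) (auto simp: finite_corners)
  also have "\<dots> = (\<Sum>v\<in>corners f. k v) * r ^ m" by (simp add: sum_distrib_right)
  also have "(\<Sum>v\<in>corners f. k v) = 2 * (\<alpha> * h\<^sub>a) + 2 * (\<beta> * h\<^sub>b)"
    unfolding f sum_corners by (simp add: k_def f)
  also have "\<dots> \<le> r * (h\<^sub>a + h\<^sub>b)"
  proof -
    have "0 \<le> \<alpha> * h\<^sub>a" "0 \<le> \<beta> * h\<^sub>b" using pos by simp_all
    then show ?thesis unfolding distrib_left using super_a super_b by linarith
  qed
  finally show ?thesis using pos Suc by (simp add: mult_right_mono mult.assoc mult.left_commute)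
qed

end

lemma exists_transfer_matrix:
  fixes \<alpha> \<beta> :: real
  assumes "\<alpha> > 0" "\<beta> > 0" "\<alpha> + \<beta> + 3 * \<alpha> * \<beta> < 1"
  obtains h\<^sub>a h\<^sub>b r where "transfer_matrix \<alpha> \<beta> h\<^sub>a h\<^sub>b r" "r < 1"
proof -
  have lt1: "\<alpha> < 1" "\<beta> < 1" using assms mult_pos_pos[OF assms(1,2)] by linarith+
  \<comment> \<open>With rate 1 and \<open>k\<close> the ratio of \<open>h\<^sub>b\<close> to
    \<open>h\<^sub>a\<close>, the two supersolution inequalities are an upper and a lower bound for
    \<open>k\<close>. The hypothesis says exactly that these leave room for strict
    inequality.\<close>
  have "2 * \<alpha> / (1 - \<beta>) < (1 - \<alpha>) / (2 * \<beta>)"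
    using assms lt1 by (simp add: divide_simps) (simp add: algebra_simps)
  then obtain k where k: "2 * \<alpha> / (1 - \<beta>) < k" "k < (1 - \<alpha>) / (2 * \<beta>)" using dense by blast
  have k0: "k > 0"
    using k(1) assms lt1 by (meson divide_pos_pos less_trans mult_pos_pos diff_gt_0_iff_gt zero_less_numeral)
  define r where "r = max (\<alpha> + 2 * \<beta> * k) (2 * \<alpha> / k + \<beta>)"
  have "2 * \<alpha> / k + \<beta> < 1" using k(1) k0 lt1 by (simp add: field_simps)
  moreover have "\<alpha> + 2 * \<beta> * k < 1" using k(2) assms by (simp add: field_simps)
  ultimately have "r < 1" by (simp add: r_def)
  \<comment> \<open>The vector \<open>(1 + 1 / k, 1 + k)\<close> has ratio \<open>k\<close> and both
    entries are at least 1.\<close>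
  moreover have "transfer_matrix \<alpha> \<beta> (1 + 1 / k) (1 + k) r"
  proof
    show "r > 0" using assms k0 by (auto simp: r_def less_max_iff_disj intro!: add_pos_pos)
    have e: "1 + k = k * (1 + 1 / k)" using k0 by (simp add: field_simps)
    have "\<alpha> * (1 + 1 / k) + 2 * (\<beta> * (1 + k)) = (\<alpha> + 2 * \<beta> * k) * (1 + 1 / k)"
      unfolding e by (simp add: algebra_simps)
    also have "\<dots> \<le> r * (1 + 1 / k)" using k0 by (intro mult_right_mono) (auto simp: r_def)
    finally show "\<alpha> * (1 + 1 / k) + 2 * (\<beta> * (1 + k)) \<le> r * (1 + 1 / k)" .
    have "2 * (\<alpha> * (1 + 1 / k)) + \<beta> * (1 + k) = (2 * \<alpha> / k + \<beta>) * (1 + k)"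
      using k0 by (simp add: field_simps)
    also have "\<dots> \<le> r * (1 + k)" using k0 by (intro mult_right_mono) (auto simp: r_def)
    finally show "2 * (\<alpha> * (1 + 1 / k)) + \<beta> * (1 + k) \<le> r * (1 + k)" .
  qed (use assms k0 in auto)
  ultimately show thesis using that by blast
qed

section \<open>Union bound for long trails\<close>

definition long_trail :: "nat \<Rightarrow> nat \<Rightarrow> edge set \<Rightarrow> bool" where
  "long_trail n L x \<longleftrightarrow> (\<exists>f vs. trail n x f vs \<and> L \<le> length vs)"

lemma trail_length_le: "trail n x f vs \<Longrightarrow> length vs \<le> n\<^sup>2"
proof -
  assume "trail n x f vs"
  then have "distinct vs" "set vs \<subseteq> vertices n" using path_types unfolding trail_def by blast+
  then have "length vs \<le> card (vertices n)"
    using card_mono[OF finite_vertices] distinct_card by metis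
  then show ?thesis by (simp add: vertices_def power2_eq_square)
qed

lemma long_trail_longest:
  assumes "long_trail n L x"
  obtains f vs where "longest_trail n x f vs" "L \<le> length vs"
proof -
  obtain g ws where g: "trail n x g ws" "L \<le> length ws" using assms by (auto simp: long_trail_def)
  define Q where "Q l \<longleftrightarrow> (\<exists>f vs. trail n x f vs \<and> length vs = l)" for l
  have "Q (length ws)" "\<And>l. Q l \<Longrightarrow> l \<le> n\<^sup>2" using g trail_length_le unfolding Q_def by blast+
  then have "Q (Greatest Q)" "\<And>l. Q l \<Longrightarrow> l \<le> Greatest Q"
    by (auto intro: GreatestI_nat Greatest_le_nat)
  then show thesis using that g unfolding Q_def longest_trail_def
    by (metis le_trans)
qed

lemma sum_le_sum_sum:
  fixes h :: "'a \<Rightarrow> real"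
  assumes "finite I" "finite X" "\<And>x. x \<in> X \<Longrightarrow> 0 \<le> h x" "\<And>x. x \<in> X \<Longrightarrow> Q x \<Longrightarrow> \<exists>i\<in>I. R i x"
  shows "(\<Sum>x | x \<in> X \<and> Q x. h x) \<le> (\<Sum>i\<in>I. \<Sum>x | x \<in> X \<and> R i x. h x)"
proof -
  have "(\<Sum>x | x \<in> X \<and> Q x. h x) = (\<Sum>x\<in>X. if Q x then h x else 0)"
    using assms(2) by (simp add: sum.inter_filter)
  also have "\<dots> \<le> (\<Sum>x\<in>X. \<Sum>i\<in>I. if R i x then h x else 0)"
  proof (rule sum_mono)
    fix x assume x: "x \<in> X"
    show "(if Q x then h x else 0) \<le> (\<Sum>i\<in>I. if R i x then h x else 0)"
    proof (cases "Q x")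
      case True
      then obtain i where "i \<in> I" "R i x" using assms(4) x by blast
      then show ?thesis
        using member_le_sum[of i I "\<lambda>i. if R i x then h x else 0"] assms(1,3) x True by auto
    next
      case False
      then show ?thesis using assms(3) x by (auto intro!: sum_nonneg)
    qed
  qed
  also have "\<dots> = (\<Sum>i\<in>I. \<Sum>x | x \<in> X \<and> R i x. h x)"
    using assms(2) by (subst sum.swap) (simp add: sum.inter_filter)
  finally show ?thesis .
qed

lemma long_trail_weight_le:
  assumes pos: "a > 0" "b > 0" "c > 0" and tm: "transfer_matrix (a / c) (b / c) h\<^sub>a h\<^sub>b r"
    and r: "r < 1" and L: "L > 0"
  shows "(\<Sum>x | x \<in> states n \<and> long_trail n L x. weight n a b c x)
    \<le> real ((n + 1)\<^sup>2 * (n\<^sup>2 + 1)) * (h\<^sub>a + h\<^sub>b) * r ^ L * (\<Sum>x\<in>states n. weight n a b c x)"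
proof -
  interpret transfer_matrix "a / c" "b / c" h\<^sub>a h\<^sub>b r by fact
  define Z where "Z = (\<Sum>x\<in>states n. weight n a b c x)"
  have Z: "Z > 0" unfolding Z_def by (rule partition_function_pos[OF \<open>a > 0\<close> \<open>b > 0\<close> \<open>c > 0\<close>])
  \<comment> \<open>\<open>(0, 0)\<close> is not a vertex, so it forbids no first step.\<close>
  define I where "I = (SIGMA i:all_cells n \<times> {L..n\<^sup>2}. nonbacktracking (snd i) (fst i) (0, 0))"
  have fin: "finite (all_cells n)" by (simp add: all_cells_def)
  have "(\<Sum>x | x \<in> states n \<and> long_trail n L x. weight n a b c x)
      \<le> (\<Sum>i\<in>I. \<Sum>x | x \<in> states n \<and> longest_trail n x (fst (fst i)) (snd i). weight n a b c x)"
  proof (rule sum_le_sum_sum)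
    show "finite I"
      unfolding I_def using fin by (auto simp: finite_nonbacktracking intro!: finite_SigmaI)
    show "finite (states n)" by (rule finite_states)
    show "0 \<le> weight n a b c x" for x
      using weight_pos[OF \<open>a > 0\<close> \<open>b > 0\<close> \<open>c > 0\<close>] by (simp add: less_imp_le)
    fix x assume "x \<in> states n" "long_trail n L x"
    then obtain f vs where l: "longest_trail n x f vs"
      "L \<le> length vs" using long_trail_longest by blast
    then have t: "trail n x f vs" by (simp add: longest_trail_def)
    have "(0, 0) \<notin> set vs" using t path_types by (fastforce simp: trail_def vertices_def)
    then have "vs \<in> nonbacktracking (length vs) f (0, 0)" using trail_nonbacktracking[OF t] by simp
    \<comment> \<open>By \<open>L > 0\<close> the trail is nonempty, so its start has a corner in
      the grid; an empty trail could start anywhere.\<close>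
    moreover have "f \<in> all_cells n"
      using t l(2) L
        by (cases f; cases vs) (auto simp: trail_def touches_def all_cells_def vertices_def split: if_splits)
    ultimately have "((f, length vs), vs) \<in> I" using l(2) trail_length_le[OF t] by (simp add: I_def)
    then show "\<exists>i\<in>I. longest_trail n x (fst (fst i)) (snd i)" using l by force
  qed
  also have "\<dots> \<le> (\<Sum>i\<in>I. path_weight (a / c) (b / c) (fst (fst i)) (snd i) * Z)"
    unfolding Z_def
      by (rule sum_mono) (rule sum_weight_longest_trail_le[OF \<open>a > 0\<close> \<open>b > 0\<close> \<open>c > 0\<close>])
  also have "\<dots> = (\<Sum>i\<in>all_cells n \<times> {L..n\<^sup>2}. \<Sum>vs\<in>nonbacktracking (snd i) (fst i) (0, 0).
      path_weight (a / c) (b / c) (fst i) vs * Z)"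
    unfolding I_def using fin by (subst sum.Sigma) (auto simp: finite_nonbacktracking split_beta)
  also have "\<dots> \<le> (\<Sum>i\<in>all_cells n \<times> {L..n\<^sup>2}. (h\<^sub>a + h\<^sub>b) * r ^ L * Z)"
  proof (rule sum_mono)
    fix i assume i: "i \<in> all_cells n \<times> {L..n\<^sup>2}"
    have "(\<Sum>vs\<in>nonbacktracking (snd i) (fst i) (0, 0). path_weight (a / c) (b / c) (fst i) vs)
        \<le> (h\<^sub>a + h\<^sub>b) * r ^ snd i"
      by (rule sum_nonbacktracking)
    also have "\<dots> \<le> (h\<^sub>a + h\<^sub>b) * r ^ L"
      using i r transfer_matrix.pos[OF tm] by (intro mult_left_mono power_decreasing) auto
    finally show "(\<Sum>vs\<in>nonbacktracking (snd i) (fst i) (0, 0). path_weight (a / c) (b / c) (fst i) vs * Z)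
        \<le> (h\<^sub>a + h\<^sub>b) * r ^ L * Z"
      using Z by (simp add: sum_distrib_right[symmetric] mult_right_mono)
  qed
  also have "\<dots> = real (card (all_cells n \<times> {L..n\<^sup>2})) * ((h\<^sub>a + h\<^sub>b) * r ^ L * Z)"
    by simp
  also have "\<dots> \<le> real ((n + 1)\<^sup>2 * (n\<^sup>2 + 1)) * ((h\<^sub>a + h\<^sub>b) * r ^ L * Z)"
  proof (rule mult_right_mono)
    have "card (all_cells n) = (n + 1)\<^sup>2"
      by (simp add: all_cells_def power2_eq_square nat_add_distrib)
    then show "real (card (all_cells n \<times> {L..n\<^sup>2})) \<le> real ((n + 1)\<^sup>2 * (n\<^sup>2 + 1))"
      unfolding card_cartesian_product of_nat_le_iff by (intro mult_le_mono) auto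
    show "0 \<le> (h\<^sub>a + h\<^sub>b) * r ^ L * Z" using transfer_matrix.pos[OF tm] Z by simp
  qed
  finally show ?thesis by (simp add: Z_def mult.assoc)
qed

section \<open>The dominating phase\<close>

declare type_a.simps [simp del] type_b.simps [simp del] type_c.simps [simp del]

section \<open>Connectivity along walls\<close>

definition wall_connected :: "nat \<Rightarrow> edge set \<Rightarrow> int \<times> int \<Rightarrow> int \<times> int \<Rightarrow> bool" where
  "wall_connected n x f g \<longleftrightarrow> (\<exists>vs. path n x f vs \<and> foldl opposite f vs = g)"

lemma wall_connected_refl: "wall_connected n x f f"
  unfolding wall_connected_def by (intro exI[of _ "[]"]) simp

lemma wall_connected_trans:
  assumes "wall_connected n x f g" "wall_connected n x g h"
  shows "wall_connected n x f h"
proof -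
  obtain vs ws where "path n x f vs" "foldl opposite f vs = g" "path n x g ws"
    "foldl opposite g ws = h"
    using assms by (auto simp: wall_connected_def)
  then show ?thesis unfolding wall_connected_def
    by (intro exI[of _ "vs @ ws"]) (simp add: path_append)
qed

lemma wall_connected_touches:
  assumes "v \<in> vertices n" "touches x f v" "touches x g v"
  shows "wall_connected n x f g"
proof (cases "g = f")
  case True
  then show ?thesis by (simp add: wall_connected_refl)
next
  case False
  then have "g = opposite f v" using touches_cases[OF assms(2,3)] by simp
  then show ?thesis unfolding wall_connected_def using assms by (intro exI[of _ "[v]"]) simp
qed

text \<open>Loop erasure at a vertex crossed twice. If the second crossing starts from the same cell
  as the first, the loop goes together with one crossing; if it starts from the opposite cell, the
  loop goes together with both.\<close>

lemma path_imp_trail: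
  assumes "path n x f vs"
  obtains ws where "trail n x f ws" "foldl opposite f ws = foldl opposite f vs"
proof -
  have "\<exists>ws. trail n x f ws \<and> foldl opposite f ws = foldl opposite f vs"
    using assms
  proof (induction vs rule: length_induct)
    case (1 vs)
    show ?case
    proof (cases "distinct vs")
      case True
      then show ?thesis using 1 by (auto simp: trail_def)
    next
      case False
      then obtain xs ys zs v where vs: "vs = xs @ [v] @ ys @ [v] @ zs"
        using not_distinct_decomp by blast
      define g where "g = foldl opposite f xs"
      define h where "h = foldl opposite (opposite g v) ys"
      have p: "path n x f xs" "v \<in> vertices n" "touches x g v" "touches x h v"
        "path n x (opposite h v) zs"
        and e: "foldl opposite f vs = foldl opposite (opposite h v) zs"
        using "1.prems" by (simp_all add: vs path_append g_def h_def)
      consider "h = g" | "h = opposite g v" using touches_cases[OF p(3,4)] by blast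
      then have "\<exists>us. length us < length vs \<and> path n x f us \<and> foldl opposite f us = foldl opposite f vs"
      proof cases
        case 1
        then show ?thesis using p e
          by (intro exI[of _ "xs @ [v] @ zs"]) (simp add: vs path_append g_def)
      next
        case 2
        then show ?thesis using p e by (intro exI[of _ "xs @ zs"]) (simp add: vs path_append g_def)
      qed
      then show ?thesis using "1.IH" by metis
    qed
  qed
  then show thesis using that by blast
qed

lemma path_displacement:
  "path n x f vs \<Longrightarrow> \<bar>fst (foldl opposite f vs) - fst f\<bar> \<le> int (length vs)
     \<and> \<bar>snd (foldl opposite f vs) - snd f\<bar> \<le> int (length vs)"
proof (induction vs arbitrary: f)
  case (Cons v vs)
  have "\<bar>fst (opposite f v) - fst f\<bar> \<le> 1 \<and> \<bar>snd (opposite f v) - snd f\<bar> \<le> 1"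
    using Cons.prems by (cases f; cases v) (auto simp: touches_def)
  then show ?case using Cons.IH[of "opposite f v"] Cons.prems by auto
qed simp

lemma wall_connected_near:
  assumes "\<not> long_trail n L x" "wall_connected n x f g"
  shows "\<bar>fst g - fst f\<bar> < int L" "\<bar>snd g - snd f\<bar> < int L"
proof -
  obtain ws where ws: "trail n x f ws" "foldl opposite f ws = g"
    using assms(2) path_imp_trail unfolding wall_connected_def by metis
  then have "length ws < L" using assms(1) by (meson long_trail_def not_le)
  then show "\<bar>fst g - fst f\<bar> < int L" "\<bar>snd g - snd f\<bar> < int L"
    using path_displacement[of n x f ws] ws by (auto simp: trail_def)
qed

section \<open>Parity of the walls in a row\<close>

definition wall :: "edge set \<Rightarrow> int \<times> int \<Rightarrow> bool" where
  "wall x v \<longleftrightarrow> type_a x v \<or> type_b x v"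

text \<open>The upper end of a wall serves as its representative: the properties later tested on it
  take the same value at both ends.\<close>

fun upper_face :: "edge set \<Rightarrow> int \<times> int \<Rightarrow> int \<times> int" where
  "upper_face x (i, j) = (if type_a x (i, j) then (i, j) else (i - 1, j))"

declare upper_face.simps [simp del]

lemma touches_upper_face: "wall x v \<Longrightarrow> touches x (upper_face x v) v"
  by (cases v) (auto simp: touches_def wall_def upper_face.simps)

lemma snd_upper_face: "snd (upper_face x v) = snd v"
  by (cases v) (simp add: upper_face.simps)

definition row :: "nat \<Rightarrow> edge set \<Rightarrow> (int \<times> int \<Rightarrow> bool) \<Rightarrow> int \<Rightarrow> int set" where
  "row n x P j = {i \<in> {1..int n}. wall x (i, j) \<and> P (upper_face x (i, j))}"

lemma finite_row: "finite (row n x P j)"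
  unfolding row_def by (rule finite_subset[of _ "{1..int n}"]) auto

text \<open>Every wall in the rows \<open>j\<close> and \<open>j + 1\<close> has exactly one end in
  the strip of cells between these rows. The cells of the strip that satisfy \<open>P\<close> are
  inner by \<open>side\<close>, so the number of wall ends in each of them is even.\<close>

lemma even_adjacent_rows:
  assumes x: "x \<in> states n" and j: "1 \<le> j" "j < int n"
    and inv: "\<And>f g v. v \<in> vertices n \<Longrightarrow> touches x f v \<Longrightarrow> touches x g v \<Longrightarrow> P f \<Longrightarrow> P g"
    and side: "\<not> P (0, j)" "\<not> P (int n, j)"
  shows "even (card (row n x P j)) \<longleftrightarrow> even (card (row n x P (j + 1)))"
proof -
  define D where "D p = {v \<in> vertices n. touches x (p, j) v \<and> P (p, j)}" for p
  have "even (card (D p))" if "p \<in> {0..int n}" for p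
  proof (cases "P (p, j)")
    case True
    then have "p \<noteq> 0" "p \<noteq> int n" using side by auto
    then have f: "(p, j) \<in> inner_cells n" using that j by (auto simp: inner_cells_def)
    then have "D p = {v. touches x (p, j) v}"
      using True corners_inner_cell[OF f] by (auto simp: D_def touches_def)
    then show ?thesis using even_touching_inner_cell[OF x f] by simp
  qed (simp add: D_def)
  moreover have "card (\<Union>p\<in>{0..int n}. D p) = (\<Sum>p\<in>{0..int n}. card (D p))"
  proof (rule card_UN_disjoint)
    have "p = p'" if "touches x (p, j) v" "touches x (p', j) v" for p p' v
    proof -
      obtain i k where v: "v = (i, k)" by (cases v)
      \<comment> \<open>The two ends of a wall lie in different strips, so a vertex is counted in
        only one cell.\<close>
      have "j \<noteq> 2 * k - 1 - j" by presburger
      then show ?thesis using touches_cases[OF that] unfolding v opposite.simps prod.inject by blast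
    qed
    then show "\<forall>p\<in>{0..int n}. \<forall>p'\<in>{0..int n}. p \<noteq> p' \<longrightarrow> D p \<inter> D p' = {}"
      unfolding D_def by blast
  qed (auto simp: D_def finite_vertices)
  ultimately have even: "even (card (\<Union>p\<in>{0..int n}. D p))" by (metis (no_types, lifting) dvd_sum)
  have "(\<Union>p\<in>{0..int n}. D p) = (\<lambda>i. (i, j)) ` row n x P j \<union> (\<lambda>i. (i, j + 1)) ` row n x P (j + 1)"
  proof (intro equalityI subsetI)
    fix v assume "v \<in> (\<Union>p\<in>{0..int n}. D p)"
    then obtain p where p: "v \<in> vertices n" "touches x (p, j) v" "P (p, j)" by (auto simp: D_def)
    obtain i k where v: "v = (i, k)" by (cases v)
    have w: "wall x v" using p(2) by (auto simp: touches_def wall_def split: if_splits)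
    have "P (upper_face x v)" using inv[OF p(1,2) touches_upper_face[OF w] p(3)] .
    then have "i \<in> row n x P k" using p(1) w by (auto simp: row_def v vertices_def)
    moreover have "k = j \<or> k = j + 1" using p(2) by (auto simp: touches_def v)
    ultimately show "v \<in> (\<lambda>i. (i, j)) ` row n x P j \<union> (\<lambda>i. (i, j + 1)) ` row n x P (j + 1)"
      by (auto simp: v)
  next
    fix v assume "v \<in> (\<lambda>i. (i, j)) ` row n x P j \<union> (\<lambda>i. (i, j + 1)) ` row n x P (j + 1)"
    then obtain i k where v: "v = (i, k)" "i \<in> row n x P k" "k = j \<or> k = j + 1" by auto
    then have i: "1 \<le> i" "i \<le> int n" and w: "wall x v" and P: "P (upper_face x v)"
      by (auto simp: row_def)
    have vn: "v \<in> vertices n" using i j v by (auto simp: vertices_def)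
    have "\<exists>p\<in>{0..int n}. touches x (p, j) v"
    proof (cases "k = j")
      case True
      have "upper_face x v = (if type_a x v then (i, j) else (i - 1, j))"
        by (simp add: v(1) True upper_face.simps)
      then show ?thesis using touches_upper_face[OF w] i by (auto split: if_splits)
    next
      case False
      then have "k = j + 1" using v(3) by simp
      then have "opposite (upper_face x v) v = (if type_a x v then (i - 1, j) else (i, j))"
        by (simp add: v(1) upper_face.simps)
      then show ?thesis using touches_opposite[OF touches_upper_face[OF w]] i
        by (auto split: if_splits)
    qed
    then obtain p where p: "p \<in> {0..int n}" "touches x (p, j) v" by blast
    moreover have "P (p, j)" using inv[OF vn touches_upper_face[OF w] p(2) P] .
    ultimately show "v \<in> (\<Union>p\<in>{0..int n}. D p)" using vn by (auto simp: D_def)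
  qed
  moreover have "card ((\<lambda>i. (i, j)) ` row n x P j \<union> (\<lambda>i. (i, j + 1)) ` row n x P (j + 1))
      = card (row n x P j) + card (row n x P (j + 1))"
    by (subst card_Un_disjoint) (auto simp: finite_row card_image inj_on_def)
  ultimately show ?thesis using even by simp
qed

section \<open>Walls attached to the sides, and the phase\<close>

definition side_connected :: "nat \<Rightarrow> edge set \<Rightarrow> int \<Rightarrow> int \<times> int \<Rightarrow> bool" where
  "side_connected n x s f \<longleftrightarrow> (\<exists>q. wall_connected n x (s, q) f)"

lemma side_connected_touches:
  assumes "v \<in> vertices n" "touches x f v" "touches x g v" "side_connected n x s f"
  shows "side_connected n x s g"
  using assms(4) wall_connected_trans[OF _ wall_connected_touches[OF assms(1-3)]]
  unfolding side_connected_def by blast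

text \<open>Without long trails, the walls connected to the bottom row do not reach the top row.\<close>

lemma even_detached_row:
  assumes x: "x \<in> states n" and L: "\<not> long_trail n L x" "L < n"
  shows "even (card (row n x (\<lambda>f. \<not> side_connected n x 0 f \<and> \<not> side_connected n x (int n) f) 1))"
proof -
  \<comment> \<open>The last conjunct holds for every wall in the bottom row, so it changes nothing
    there, and it leaves no wall in the top row, at height difference
    \<open>n - 1 \<ge> L\<close>.\<close>
  define P where "P f \<longleftrightarrow> \<not> side_connected n x 0 f \<and> \<not> side_connected n x (int n) f
    \<and> (\<exists>p. wall_connected n x (p, 1) f)" for f
  have inv: "P g" if "v \<in> vertices n" "touches x f v" "touches x g v" "P f" for f g v
    using that side_connected_touches[OF that(1,3,2)] wall_connected_touches[OF that(1-3)]
      wall_connected_trans unfolding P_def by blast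
  have side: "\<not> P (0, j)" "\<not> P (int n, j)" for j
    using wall_connected_refl unfolding P_def side_connected_def by blast+
  have "even (card (row n x P 1)) \<longleftrightarrow> even (card (row n x P (int k + 1)))" if "k < n" for k
    using that
  proof (induction k)
    case (Suc k)
    then have "even (card (row n x P 1)) \<longleftrightarrow> even (card (row n x P (int k + 1)))" by simp
    also have "\<dots> \<longleftrightarrow> even (card (row n x P (int k + 1 + 1)))"
      by (rule even_adjacent_rows[OF x _ _ inv side]) (use Suc.prems in auto)
    also have "int k + 1 + 1 = int (Suc k) + 1" by simp
    finally show ?case .
  qed simp
  from this[of "n - 1"] have "even (card (row n x P 1)) \<longleftrightarrow> even (card (row n x P (int n)))"
    using L by simp
  moreover have "row n x P (int n) = {}"
  proof -
    have False if "wall_connected n x (p, 1) (upper_face x (i, int n))" for p i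
      using wall_connected_near(2)[OF L(1) that] L(2) by (simp add: snd_upper_face)
    then show ?thesis by (auto simp: row_def P_def)
  qed
  moreover have "row n x P 1 = row n x (\<lambda>f. \<not> side_connected n x 0 f \<and> \<not> side_connected n x (int n) f) 1"
  proof -
    have "\<exists>p. wall_connected n x (p, 1) (upper_face x (i, 1))" for i
      using wall_connected_refl[of n x "upper_face x (i, 1)"] snd_upper_face[of x "(i, 1)"]
      by (metis prod.collapse snd_conv)
    then show ?thesis by (auto simp: row_def P_def)
  qed
  ultimately show ?thesis by simp
qed

text \<open>Which of the two \<open>c\<close>-ordered ground states dominates: the orientation of the bottom left
  dangling edge, corrected by the walls that separate it from the bulk.\<close>

definition phase :: "nat \<Rightarrow> edge set \<Rightarrow> bool" where
  "phase n x \<longleftrightarrow> (Hor 0 1 \<in> x \<longleftrightarrow> even (card (row n x (side_connected n x 0) 1)))"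

text \<open>Along the row the horizontal direction changes exactly at the vertices of type
  \<open>c\<close>, whose number is \<open>k\<close> minus the number of walls.\<close>

lemma bottom_row_parity:
  assumes "x \<in> states n" "k \<le> n"
  shows "(Hor (int k) 1 \<in> x \<longleftrightarrow> Hor 0 1 \<in> x) \<longleftrightarrow> even (k + card {i \<in> {1..int k}. wall x (i, 1)})"
  using assms(2)
proof (induction k)
  case (Suc k)
  have "(int k + 1, 1) \<in> vertices n" using Suc.prems by (auto simp: vertices_def)
  then have "type_a x (int k + 1, 1) \<or> type_b x (int k + 1, 1) \<or> type_c x (int k + 1, 1)"
    using assms(1) by (simp add: states_iff_types)
  then have w: "wall x (int k + 1, 1) \<longleftrightarrow> (Hor (int k + 1) 1 \<in> x \<longleftrightarrow> Hor (int k) 1 \<in> x)"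
    by (auto simp: wall_def type_a.simps type_b.simps type_c.simps)
  define W where "W = {i \<in> {1..int k}. wall x (i, 1)}"
  have W: "finite W" "int k + 1 \<notin> W"
    unfolding W_def by (auto intro: finite_subset[of _ "{1..int k}"])
  have "{1..int (Suc k)} = insert (int k + 1) {1..int k}" by auto
  then have "{i \<in> {1..int (Suc k)}. wall x (i, 1)} = (if wall x (int k + 1, 1) then insert (int k + 1) W else W)"
    by (auto simp: W_def)
  then have card: "card {i \<in> {1..int (Suc k)}. wall x (i, 1)} = of_bool (wall x (int k + 1, 1)) + card W"
    using W by simp
  have IH: "(Hor (int k) 1 \<in> x \<longleftrightarrow> Hor 0 1 \<in> x) \<longleftrightarrow> even (k + card W)"
    using Suc by (simp add: W_def)
  have Suc_k: "int (Suc k) = int k + 1" by simp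
  show ?case
    unfolding card unfolding Suc_k using IH w by (cases "wall x (int k + 1, 1)") auto
qed simp

text \<open>The walls in the bottom row are attached to the left side, attached to the right side or
  detached. No wall is attached to both sides, and the detached ones are even in number, so the left
  count can be traded for the right count.\<close>

lemma phase_right:
  assumes x: "x \<in> states n" and L: "\<not> long_trail n L x" "2 * L < n"
  shows "phase n x \<longleftrightarrow> (Hor (int n) 1 \<in> x \<longleftrightarrow> even (n + card (row n x (side_connected n x (int n)) 1)))"
proof -
  let ?l = "side_connected n x 0" and ?r = "side_connected n x (int n)"
  have "\<not> (?l f \<and> ?r f)" for f
  proof
    assume "?l f \<and> ?r f"
    then obtain q q' where "wall_connected n x (0, q) f" "wall_connected n x (int n, q') f"
      by (auto simp: side_connected_def)
    from this[THEN wall_connected_near(1)[OF L(1)]] show False using L(2) by simp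
  qed
  then have "{i \<in> {1..int n}. wall x (i, 1)} =
      row n x ?l 1 \<union> row n x ?r 1 \<union> row n x (\<lambda>f. \<not> ?l f \<and> \<not> ?r f) 1"
    and d: "row n x ?l 1 \<inter> row n x ?r 1 = {}"
      "(row n x ?l 1 \<union> row n x ?r 1) \<inter> row n x (\<lambda>f. \<not> ?l f \<and> \<not> ?r f) 1 = {}"
    unfolding row_def by blast+
  then have "card {i \<in> {1..int n}. wall x (i, 1)} =
      card (row n x ?l 1) + card (row n x ?r 1) + card (row n x (\<lambda>f. \<not> ?l f \<and> \<not> ?r f) 1)"
    by (simp add: card_Un_disjoint finite_row)
  moreover have "even (card (row n x (\<lambda>f. \<not> ?l f \<and> \<not> ?r f) 1))"
    using even_detached_row[OF x L(1)] L(2) by simp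
  ultimately show ?thesis
    using bottom_row_parity[OF x order_refl] unfolding phase_def by simp blast
qed

text \<open>Walks in \<open>x\<close> from column \<open>s\<close> stay in cells fewer than
  \<open>L\<close> columns away. Cells are named by their lower left corner, so the corners of these
  cells lie in the asymmetric window \<open>s - L + 1\<close> to \<open>s + L\<close>.\<close>

lemma side_connected_mono:
  assumes L: "\<not> long_trail n L x"
    and agree: "\<And>v. v \<in> vertices n \<Longrightarrow> s - int L < fst v \<Longrightarrow> fst v \<le> s + int L \<Longrightarrow>
      type_a x v = type_a y v \<and> type_b x v = type_b y v"
    and f: "side_connected n x s f"
  shows "side_connected n y s f"
proof -
  obtain q vs where "path n x (s, q) vs" "foldl opposite (s, q) vs = f"
    using f by (auto simp: side_connected_def wall_connected_def)
  moreover have "path n x (s, q) vs \<Longrightarrow> path n y (s, q) vs"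
  proof (induction vs rule: rev_induct)
    case (snoc v vs)
    define g where "g = foldl opposite (s, q) vs"
    have p: "path n x (s, q) vs" "v \<in> vertices n" "touches x g v"
      using snoc.prems by (auto simp: path_append g_def)
    then have "wall_connected n x (s, q) g" by (auto simp: wall_connected_def g_def)
    then have "\<bar>fst g - s\<bar> < int L" using wall_connected_near[OF L] by fastforce
    moreover have "fst g \<le> fst v" "fst v \<le> fst g + 1"
      using p(3) by (cases g; auto simp: touches_def)+
    ultimately have "type_a x v = type_a y v \<and> type_b x v = type_b y v"
      using agree[OF p(2)] by auto
    then have "touches y g v" using p(3) by (simp add: touches_def split: if_splits)
    then show ?case using snoc.IH p by (simp add: path_append g_def)
  qed simp
  ultimately show ?thesis by (auto simp: side_connected_def wall_connected_def)
qed

lemma side_row_subset: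
  assumes L: "\<not> long_trail n L x" and n: "n \<ge> 1"
    and agree: "\<And>v. v \<in> vertices n \<Longrightarrow> s - int L < fst v \<Longrightarrow> fst v \<le> s + int L \<Longrightarrow>
      type_a x v = type_a y v \<and> type_b x v = type_b y v"
  shows "row n x (side_connected n x s) 1 \<subseteq> row n y (side_connected n y s) 1"
proof
  fix i assume "i \<in> row n x (side_connected n x s) 1"
  then have i: "i \<in> {1..int n}" "wall x (i, 1)" "side_connected n x s (upper_face x (i, 1))"
    by (auto simp: row_def)
  have "\<bar>fst (upper_face x (i, 1)) - s\<bar> < int L"
    using i(3) wall_connected_near(1)[OF L] unfolding side_connected_def by fastforce
  moreover have "fst (upper_face x (i, 1)) \<le> i" "i \<le> fst (upper_face x (i, 1)) + 1"
    by (auto simp: upper_face.simps)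
  moreover have "(i, 1) \<in> vertices n" using i(1) n by (auto simp: vertices_def)
  ultimately have "type_a x (i, 1) = type_a y (i, 1) \<and> type_b x (i, 1) = type_b y (i, 1)"
    using agree[of "(i, 1)"] by auto
  then have "wall y (i, 1)" "upper_face y (i, 1) = upper_face x (i, 1)"
    using i(2) by (simp_all add: wall_def upper_face.simps)
  then show "i \<in> row n y (side_connected n y s) 1"
    using i side_connected_mono[OF L agree] by (simp add: row_def)
qed

lemma reverse_cell_types:
  assumes "v \<notin> corners f"
  shows "type_a (reverse_cell n x f) v = type_a x v" "type_b (reverse_cell n x f) v = type_b x v"
proof -
  obtain p q where f: "f = (p, q)" by (cases f)
  obtain i j where v: "v = (i, j)" by (cases v)
  have "\<not> ((i = p \<or> i = p + 1) \<and> (j = q \<or> j = q + 1))" using assms by (auto simp: f v)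
  then have "Hor (i - 1) j \<in> reverse_cell n x f \<longleftrightarrow> Hor (i - 1) j \<in> x"
    "Hor i j \<in> reverse_cell n x f \<longleftrightarrow> Hor i j \<in> x"
    "Ver i (j - 1) \<in> reverse_cell n x f \<longleftrightarrow> Ver i (j - 1) \<in> x"
      "Ver i j \<in> reverse_cell n x f \<longleftrightarrow> Ver i j \<in> x"
    by (auto simp: reverse_cell_def Let_def f)
  then show "type_a (reverse_cell n x f) v = type_a x v"
    "type_b (reverse_cell n x f) v = type_b x v"
    by (simp_all add: v type_a.simps type_b.simps)
qed

text \<open>The reversed cell is outside the window of the left or of the right side; the phase is
  read off from a side that it cannot influence.\<close>

lemma phase_reverse_cell:
  assumes x: "x \<in> states n" "\<not> long_trail n L x" and y: "y \<in> states n" "\<not> long_trail n L y"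
    and yx: "y = reverse_cell n x f" and L: "2 * L < n"
  shows "phase n y \<longleftrightarrow> phase n x"
proof -
  obtain p q where f: "f = (p, q)" by (cases f)
  have n: "n \<ge> 1" using L by simp
  have rows: "row n x (side_connected n x s) 1 = row n y (side_connected n y s) 1"
    if "p + 1 \<le> s - int L \<or> s + int L < p" for s
  proof -
    have "type_a x v = type_a y v \<and> type_b x v = type_b y v" if "s - int L < fst v"
      "fst v \<le> s + int L" for v
    proof -
      have "v \<notin> corners f" using that \<open>p + 1 \<le> s - int L \<or> s + int L < p\<close> by (auto simp: f)
      then show ?thesis using reverse_cell_types[of v f n x] yx by simp
    qed
    then show ?thesis using side_row_subset[OF x(2) n, of s y] side_row_subset[OF y(2) n, of s x]
      by blast
  qed
  show ?thesis
  proof (cases "int L < p")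
    case True
    then have "Hor 0 1 \<in> y \<longleftrightarrow> Hor 0 1 \<in> x" by (auto simp: yx f reverse_cell_def Let_def)
    then show ?thesis using rows[of 0] True by (simp add: phase_def)
  next
    \<comment> \<open>Now \<open>p \<le> L\<close>, and \<open>2 * L < n\<close> gives
      \<open>p + 1 \<le> n - L\<close>: the cell avoids the window of the right side.\<close>
    case False
    then have "p \<noteq> int n" using L by simp
    then have "Hor (int n) 1 \<in> y \<longleftrightarrow> Hor (int n) 1 \<in> x" by (auto simp: yx f reverse_cell_def Let_def)
    then show ?thesis
      using rows[of "int n"] False L phase_right[OF x L] phase_right[OF y L] by simp
  qed
qed

section \<open>Symmetry under reversing all edges\<close>

lemma type_reversal:
  assumes "v \<in> vertices n"
  shows "type_a (edges n - x) v = type_a x v" "type_b (edges n - x) v = type_b x v"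
    "type_c (edges n - x) v = type_c x v"
  using assms by (cases v; auto simp: vertices_def type_a.simps type_b.simps type_c.simps)+

lemma reversal_in_states: "x \<in> states n \<Longrightarrow> edges n - x \<in> states n"
  by (auto simp: states_iff_types type_reversal)

lemma weight_reversal: "weight n a b c (edges n - x) = weight n a b c x"
  by (simp add: weight_def type_reversal cong: conj_cong)

lemma path_reversal: "path n (edges n - x) f vs = path n x f vs"
  by (induction vs arbitrary: f) (auto simp: touches_def type_reversal)

lemma long_trail_reversal: "long_trail n L (edges n - x) = long_trail n L x"
  by (simp add: long_trail_def trail_def path_reversal)

text \<open>Reversing all edges leaves the types and hence the walls in place, whereas the reference
  edge \<open>Hor 0 1\<close> turns around.\<close>

lemma phase_reversal:
  assumes "x \<in> states n" "n \<ge> 1"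
  shows "phase n (edges n - x) \<longleftrightarrow> \<not> phase n x"
proof -
  have "side_connected n (edges n - x) s = side_connected n x s" for s
    by (simp add: fun_eq_iff side_connected_def wall_connected_def path_reversal)
  moreover have "wall (edges n - x) (i, 1) = wall x (i, 1)"
    "upper_face (edges n - x) (i, 1) = upper_face x (i, 1)"
    if "i \<in> {1..int n}" for i
  proof -
    have "(i, 1) \<in> vertices n" using that assms(2) by (auto simp: vertices_def)
    then show "wall (edges n - x) (i, 1) = wall x (i, 1)"
      "upper_face (edges n - x) (i, 1) = upper_face x (i, 1)"
      by (simp_all add: wall_def type_reversal upper_face.simps)
  qed
  ultimately have "row n (edges n - x) (side_connected n (edges n - x) 0) 1 = row n x (side_connected n x 0) 1"
    unfolding row_def by auto
  moreover have "Hor 0 1 \<in> edges n - x \<longleftrightarrow> Hor 0 1 \<notin> x" using assms(2) by simp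
  ultimately show ?thesis by (auto simp: phase_def)
qed

section \<open>Slow mixing\<close>

lemma sum_boltzmann_reversal:
  assumes "\<And>x. x \<in> states n \<Longrightarrow> Q (edges n - x) \<longleftrightarrow> R x" "\<And>x. x \<in> states n \<Longrightarrow> R (edges n - x) \<longleftrightarrow> Q x"
  shows "sum (boltzmann n a b c) {x \<in> states n. Q x} = sum (boltzmann n a b c) {x \<in> states n. R x}"
proof (rule sum.reindex_bij_witness[where i = "\<lambda>x. edges n - x" and j = "\<lambda>x. edges n - x"])
  have "edges n - (edges n - x) = x" if "x \<in> states n" for x
    using that by (auto simp: states_def)
  then show "edges n - (edges n - x) = x" if "x \<in> {x \<in> states n. Q x}" for x using that by simp
  show "edges n - (edges n - x) = x" if "x \<in> {x \<in> states n. R x}" for x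
    using that by (auto simp: states_def)
qed (auto simp: assms reversal_in_states boltzmann_def weight_reversal)

text \<open>The last hypothesis takes the place of \<open>r \<le> 3 / (64 * \<delta>)\<close>, so
  that \<open>\<delta> = 0\<close> is covered without division and then gives an infinite mixing
  time.\<close>

lemma glauber_bottleneck:
  assumes pos: "a > 0" "b > 0" "c > 0" and F: "finite F" "F \<noteq> {}"
    and S: "states n = A \<union> C \<union> B" "A \<inter> C = {}" "(A \<union> C) \<inter> B = {}"
    and sep: "\<And>x y f. x \<in> A \<Longrightarrow> y \<in> B \<Longrightarrow> f \<in> F \<Longrightarrow> y \<noteq> reverse_cell n x f"
    and sym: "sum (boltzmann n a b c) A = sum (boltzmann n a b c) B"
    and small: "sum (boltzmann n a b c) C \<le> \<delta>" "\<delta> \<le> 1 / 4"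
    and r: "\<And>t. 3 / 64 \<le> real t * \<delta> \<Longrightarrow> r \<le> real t"
  shows "ereal r \<le> ereal_of_enat (glauber_mixing_time F n a b c)"
  unfolding glauber_mixing_time_def
proof (rule mixing_time_ge)
  let ?\<pi> = "boltzmann n a b c"
  fix t assume mix: "\<And>x. x \<in> states n \<Longrightarrow>
      tv_dist (states n) (matrix_power (states n) (glauber F n a b c) t x) ?\<pi> \<le> 1 / 4"
  have fin: "finite A" "finite B" "finite C" using finite_states[of n] S(1) by auto
  have total: "sum ?\<pi> A + sum ?\<pi> C + sum ?\<pi> B = 1"
    using sum_boltzmann_states[OF pos, of n] fin S by (simp add: sum.union_disjoint)
  have "sum ?\<pi> A * (sum ?\<pi> B - 1 / 4) \<le> real t * sum ?\<pi> C"
  proof (rule bottleneck[OF finite_states glauber_nonneg[OF pos] glauber_row_sum[OF F]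
        glauber_reversible[OF pos] less_imp_le[OF boltzmann_pos[OF pos]] sum_boltzmann_states[OF pos] S])
    show "glauber F n a b c x y = 0" if "x \<in> A" "y \<in> B" for x y
      using that S sep by (intro glauber_eq_0) auto
    show "tv_dist (states n) (matrix_power (states n) (glauber F n a b c) t x) ?\<pi> \<le> 1 / 4" if "x \<in> A" for x
      using that S(1) by (intro mix) simp
  qed
  \<comment> \<open>Since \<open>\<delta> \<le> 1 / 4\<close>, each phase has mass at least
    \<open>(1 - 1 / 4) / 2 = 3 / 8\<close>, which exceeds the mixing threshold by
    \<open>1 / 8\<close>; the product is \<open>3 / 64\<close>.\<close>
  moreover have "3 / 8 \<le> sum ?\<pi> A" using total sym small by simp
  then have "3 / 8 * (1 / 8) \<le> sum ?\<pi> A * (sum ?\<pi> B - 1 / 4)"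
    using sym by (intro mult_mono) auto
  moreover have "real t * sum ?\<pi> C \<le> real t * \<delta>" using small by (simp add: mult_left_mono)
  ultimately show "r \<le> real t" by (intro r) linarith
qed (rule finite_states)

text \<open>The direction of \<open>Hor 0 1\<close> is conserved, so the bottleneck is empty; with
  \<open>\<delta> = 0\<close> the bound holds for every real \<open>r\<close>.\<close>

lemma inner_cells_mixing_time:
  assumes pos: "a > 0" "b > 0" "c > 0" and n: "n \<ge> 2"
  shows "ereal r \<le> ereal_of_enat (glauber_mixing_time (inner_cells n) n a b c)"
proof (rule glauber_bottleneck[OF pos, where A = "{x \<in> states n. Hor 0 1 \<in> x}"
      and B = "{x \<in> states n. Hor 0 1 \<notin> x}" and C = "{}" and \<delta> = 0])
  show "finite (inner_cells n)" "inner_cells n \<noteq> {}" using n by (auto simp: inner_cells_def)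
  show "y \<noteq> reverse_cell n x f"
    if "x \<in> {x \<in> states n. Hor 0 1 \<in> x}" "y \<in> {x \<in> states n. Hor 0 1 \<notin> x}"
      "f \<in> inner_cells n" for x y f
    using that by (cases f) (auto simp: inner_cells_def reverse_cell_def Let_def)
  show "sum (boltzmann n a b c) {x \<in> states n. Hor 0 1 \<in> x}
      = sum (boltzmann n a b c) {x \<in> states n. Hor 0 1 \<notin> x}"
    using n by (intro sum_boltzmann_reversal) auto
qed auto

lemma all_cells_mixing_time:
  assumes pos: "a > 0" "b > 0"
    "c > 0" and tm: "transfer_matrix (a / c) (b / c) h\<^sub>a h\<^sub>b r" and r: "r < 1"
    and n: "n \<ge> 3"
    and \<delta>: "\<delta> = real ((n + 1)\<^sup>2 * (n\<^sup>2 + 1)) * (h\<^sub>a + h\<^sub>b) * r ^ (n div 3)"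
    and E: "E \<ge> 1" "\<delta> * E \<le> 3 / 64"
  shows "ereal E \<le> ereal_of_enat (glauber_mixing_time (all_cells n) n a b c)"
proof -
  define L where "L = n div 3"
  have L: "L > 0" "2 * L < n" using n by (auto simp: L_def)
  have "0 < real ((n + 1)\<^sup>2 * (n\<^sup>2 + 1))" unfolding of_nat_0_less_iff by simp
  then have "\<delta> > 0"
    using transfer_matrix.pos[OF tm] unfolding \<delta>
      by (intro mult_pos_pos) (auto simp del: of_nat_mult)
  show ?thesis
  proof (rule glauber_bottleneck[OF pos, where A = "{x \<in> states n. \<not> long_trail n L x \<and> phase n x}"
        and B = "{x \<in> states n. \<not> long_trail n L x \<and> \<not> phase n x}" and C = "{x \<in> states n. long_trail n L x}"
        and \<delta> = \<delta>])
    show "finite (all_cells n)" "all_cells n \<noteq> {}" by (auto simp: all_cells_def)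
    show "y \<noteq> reverse_cell n x f"
      if "x \<in> {x \<in> states n. \<not> long_trail n L x \<and> phase n x}"
        "y \<in> {x \<in> states n. \<not> long_trail n L x \<and> \<not> phase n x}" for x y f
      using that phase_reverse_cell[of x n L y f] L by auto
    show "sum (boltzmann n a b c) {x \<in> states n. \<not> long_trail n L x \<and> phase n x}
        = sum (boltzmann n a b c) {x \<in> states n. \<not> long_trail n L x \<and> \<not> phase n x}"
      using n by (intro sum_boltzmann_reversal) (auto simp: long_trail_reversal phase_reversal)
    show "sum (boltzmann n a b c) {x \<in> states n. long_trail n L x} \<le> \<delta>"
      using long_trail_weight_le[OF pos tm r L(1), of n] partition_function_pos[OF pos, of n]
      by (simp add: sum_boltzmann \<delta> L_def pos_divide_le_eq)
    have "\<delta> * 1 \<le> \<delta> * E" using E(1) \<open>\<delta> > 0\<close> by (intro mult_left_mono) auto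
    then show "\<delta> \<le> 1 / 4" using E(2) by simp
    show "E \<le> real t" if "3 / 64 \<le> real t * \<delta>" for t
    proof -
      have "\<delta> * E \<le> \<delta> * real t" using that E(2) by (simp add: mult.commute)
      then show ?thesis using \<open>\<delta> > 0\<close> by simp
    qed
  qed auto
qed

text \<open>Any exponent below 1 could replace \<open>1 / 2\<close>, because
  \<open>r ^ (n div 3)\<close> decays exponentially in \<open>n\<close>.\<close>

lemma eventually_small:
  fixes r H :: real
  assumes "0 < r" "r < 1" "H > 0"
  shows "\<forall>\<^sub>F n in sequentially.
    real ((n + 1)\<^sup>2 * (n\<^sup>2 + 1)) * H * r ^ (n div 3) * exp (real n powr (1 / 2)) \<le> 3 / 64"
proof -
  define m where "m = - ln r"
  have m: "m > 0" using assms by (simp add: m_def)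
  \<comment> \<open>The real number \<open>n / 3 - 1\<close> is a lower bound for
    \<open>n div 3\<close> and removes the integer division from the limit.\<close>
  have "((\<lambda>n. real ((n + 1)\<^sup>2 * (n\<^sup>2 + 1)) * H * exp (- m * (real n / 3 - 1))
      * exp (real n powr (1 / 2))) \<longlongrightarrow> 0) sequentially"
    using m assms(3) by real_asymp
  then have "\<forall>\<^sub>F n in sequentially.
      real ((n + 1)\<^sup>2 * (n\<^sup>2 + 1)) * H * exp (- m * (real n / 3 - 1)) * exp (real n powr (1 / 2)) < 3 / 64"
    by (rule order_tendstoD) simp
  then show ?thesis
  proof eventually_elim
    case (elim n)
    have "r ^ (n div 3) = exp (- m * real (n div 3))"
      using assms by (simp add: m_def exp_of_nat_mult mult.commute[of "ln r"])
    also have "\<dots> \<le> exp (- m * (real n / 3 - 1))"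
    proof -
      have "real n / 3 - 1 \<le> real (n div 3)" by linarith
      then show ?thesis using m by (simp add: mult_left_mono)
    qed
    finally have "real ((n + 1)\<^sup>2 * (n\<^sup>2 + 1)) * H * r ^ (n div 3) * exp (real n powr (1 / 2))
      \<le> real ((n + 1)\<^sup>2 * (n\<^sup>2 + 1)) * H * exp (- m * (real n / 3 - 1)) * exp (real n powr (1 / 2))"
      using assms(3) by (intro mult_right_mono mult_left_mono) auto
    then show ?case using elim by linarith
  qed
qed

theorem theorem2:
  fixes a b c :: real
  assumes "a > 0" and "b > 0" and "c > 0"
    and "a * c + b * c + 3 * a * b < c\<^sup>2"
  shows "exponentially_slow (\<lambda>n. glauber_mixing_time (all_cells n) n a b c) \<and>
         exponentially_slow (\<lambda>n. glauber_mixing_time (inner_cells n) n a b c)"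
proof
  have "a / c + b / c + 3 * (a / c) * (b / c) < 1"
  proof -
    have "a / c + b / c + 3 * (a / c) * (b / c) = (a * c + b * c + 3 * a * b) / c\<^sup>2"
      using assms by (simp add: field_simps power2_eq_square)
    then show ?thesis using assms by simp
  qed
  then obtain h\<^sub>a h\<^sub>b r where tm: "transfer_matrix (a / c) (b / c) h\<^sub>a h\<^sub>b r" and r: "r < 1"
    using exists_transfer_matrix[of "a / c" "b / c"] assms by auto
  have "\<forall>\<^sub>F n in sequentially.
    real ((n + 1)\<^sup>2 * (n\<^sup>2 + 1)) * (h\<^sub>a + h\<^sub>b) * r ^ (n div 3) * exp (real n powr (1 / 2)) \<le> 3 / 64"
    using transfer_matrix.pos[OF tm] r by (intro eventually_small) auto
  then have "\<forall>\<^sub>F n in sequentially. ereal (1 * exp (real n powr (1 / 2)))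
      \<le> ereal_of_enat (glauber_mixing_time (all_cells n) n a b c)"
    using eventually_ge_at_top[of 3]
  proof eventually_elim
    case (elim n)
    then show ?case using all_cells_mixing_time[OF assms(1-3) tm r _ refl, of n "exp (real n powr (1 / 2))"]
      by simp
  qed
  then show "exponentially_slow (\<lambda>n. glauber_mixing_time (all_cells n) n a b c)"
    unfolding exponentially_slow_def by (intro exI[of _ "1 / 2"] conjI exI[of _ 1]) auto
  \<comment> \<open>The exponent 1 is an arbitrary choice, since the bound for the inner cells holds
    for every real number.\<close>
  have "\<forall>\<^sub>F n in sequentially. ereal (1 * exp (real n powr 1))
      \<le> ereal_of_enat (glauber_mixing_time (inner_cells n) n a b c)"
    using eventually_ge_at_top[of 2]
      by eventually_elim (rule inner_cells_mixing_time[OF assms(1-3)])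
  then show "exponentially_slow (\<lambda>n. glauber_mixing_time (inner_cells n) n a b c)"
    unfolding exponentially_slow_def by (intro exI[of _ 1] conjI) auto
qed

end
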